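(* Assume that $\{J_n\}_{n\in\mathbb{N}}$ has stationary initial distribution $\boldsymbol{\pi}$ and that the initial surplus is $X_0=0$. Then $$\mathbb{P}(\tau_0^-=1,J_1)=\mathbf{P}-\mathbf{\Lambda}(0),$$ whilst for $n>1$, $$\mathbb{P}(\tau_0^-=n,J_n)=\sum_{y=1}^{n-1}\mathbf{V}(n-1,y)\,\mathbf{P}-\sum_{y=1}^{n}\mathbf{V}(n,y).$$
   Context: $\mathbb{N}=\{0,1,2,\dots\}$. $\{J_n\}_{n\in\mathbb{N}}$ is an ergodic time-homogeneous Markov chain on $E=\{1,\dots,N\}$ with transition matrix $\mathbf{P}$ and stationary distribution $\boldsymbol{\pi}$. The claims $\{C_k\}_{k\ge1}$ are non-negative integer-valued and conditionally i.i.d. given the chain in the sense that $(C,J)$ has the Markov additive property: given $J_{k-1}=i$, the pair $(C_k,J_k)$ is independent of the past and $\lambda_{ij}(m):=\mathbb{P}(C_k=m,J_k=j\mid J_{k-1}=i)$ does not depend on $k$. $\mathbf{\Lambda}(m)=(\lambda_{ij}(m))_{i,j\in E}$, so $\sum_{m\ge0}\mathbf{\Lambda}(m)=\mathbf{P}$. Standing assumption: $\lambda_{ij}(0)>0$ for all $i,j\in E$ and $\mathbf{\Lambda}(0)$ is invertible. The surplus process with zero initial surplus is $X_n=n-\sum_{k=1}^nC_k$. The ruin time is $\tau_0^-=\min\{n>0:X_n\leq0\}$ (with $\min\emptyset=\infty$). The notation $\mathbb{P}(\tau_0^-=n,J_n)$ is the $N\times N$ matrix with $(i,j)$ entry $\mathbb{P}(\tau_0^-=n,J_n=j\mid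 J_0=i)$. Definition of $\mathbf{V}(n,a)$. Let $\mathbf{R}=(R_{ij})_{i,j\in E}$ be a matrix of $N^2$ independent variables and $D_{ij}=\partial/\partial R_{ij}$. Put $\widehat{\mathbf{\Lambda}}^{\rightarrow}(\mathbf{R})=\sum_{m\ge0}\mathbf{R}^m\mathbf{\Lambda}(m)$ and $\widehat\lambda^{\rightarrow}_{ij}(\mathbf{R})=(\widehat{\mathbf{\Lambda}}^{\rightarrow}(\mathbf{R}))_{ij}$. Let $\mathbf{\Gamma}^{\rightarrow}(\mathbf{R})$ be the $N^2\times N^2$ matrix with entries $\gamma_{ij,kl}(\mathbf{R})=R_{ij}\,D_{kl}\{\ln[\widehat\lambda^{\rightarrow}_{ij}(\mathbf{R})]\}$, $i,j,k,l\in E$ (rows indexed by pairs $ij$, columns by pairs $kl$), let $\mathbf{I}$ be the $N^2\times N^2$ identity matrix and $|\cdot|$ the determinant. Then $$\mathbf{V}(n,a)=\sum_{\substack{x_{11},\dots,x_{NN}\ge0\\ x_{11}+\cdots+x_{NN}=n}}\frac{1}{x_{11}!\cdots x_{NN}!}\,\mathbf{C}(\vec x,a),$$ $$\mathbf{C}(\vec x,a)=\left[\prod_{i=1}^N\prod_{j=1}^ND_{ij}^{x_{ij}}\left(\mathbf{R}^a\prod_{i=1}^N\prod_{j=1}^N\widehat\lambda^{\rightarrow}_{ij}(\mathbf{R})^{x_{ij}}\,\big|\mathbf{I}-\mathbf{\Gamma}^{\rightarrow}(\mathbf{R})\big|\right)\right]_{\mathbf{R}=\mathbf{0}},$$ where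 the sum is over vectors $\vec x=(x_{ij})_{i,j\in E}$ of $N^2$ non-negative integers, the differential operators act on everything to their right, and they act element-wise on the matrix $\mathbf{R}^a$. *)

theory Defs
  imports "HOL-Probability.Probability"
begin

(* real^'n^'n without the sort constraint finite that this notation attaches to 'n, for use where
   'n has a larger sort. *)
type_synonym 'n sqmat = "((real, 'n) vec, 'n) vec"

section \<open>The Markov additive risk model\<close>

(* The multiplication of the type class times on vec is componentwise, so ^ is not the matrix power. *)
definition mat_pow :: "real^'n^'n \<Rightarrow> nat \<Rightarrow> real^'n^'n" where
  "mat_pow A m = (((**) A) ^^ m) (mat 1)"

definition stochastic_matrix :: "real^'n^'n \<Rightarrow> bool" where
  "stochastic_matrix P \<longleftrightarrow> (\<forall>i j. 0 \<le> P $ i $ j) \<and> (\<forall>i. (\<Sum>j\<in>UNIV. P $ i $ j) = 1)"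

(* Ergodic means irreducible and aperiodic; positive recurrence is automatic on a finite
   state space. *)
definition ergodic_matrix :: "real^'n^'n \<Rightarrow> bool" where
  "ergodic_matrix P \<longleftrightarrow>
     (\<forall>i j. \<exists>n. 0 < mat_pow P n $ i $ j) \<and>
     (\<forall>i. Gcd {n. 0 < n \<and> 0 < mat_pow P n $ i $ i} = 1)"

definition stationary_distribution :: "real^'n^'n \<Rightarrow> real^'n \<Rightarrow> bool" where
  "stationary_distribution P p \<longleftrightarrow>
     (\<forall>i. 0 \<le> p $ i) \<and> (\<Sum>i\<in>UNIV. p $ i) = 1 \<and> p v* P = p"

(* The state space E = {1..N} is the finite type 'n. The claims are C 1, C 2, ...; the value C 0
   plays no role. The kernel is a parameter, tied to the process only at states of positive
   probability, because cond_prob is 0 when its condition is null.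
   In conditional_independence, the past before step k is (J 0, ..., J (k - 1), C 1, ..., C (k - 1));
   it is discrete, so it suffices to treat its atoms. Both sides are 0 when
   the event J (k - 1) = i is null. *)
locale map_risk_model = prob_space M
  for M :: "'a measure" +
  fixes J :: "nat \<Rightarrow> 'a \<Rightarrow> 'n::finite"
    and C :: "nat \<Rightarrow> 'a \<Rightarrow> nat"
    and P :: "real^'n^'n"
    and \<Lambda> :: "nat \<Rightarrow> real^'n^'n"
    and \<pi> :: "real^'n"
  assumes J_measurable: "\<And>n. J n \<in> measurable M (count_space UNIV)"
    and C_measurable: "\<And>k. 1 \<le> k \<Longrightarrow> C k \<in> measurable M (count_space UNIV)"
    and P_stochastic: "stochastic_matrix P"
    and P_ergodic: "ergodic_matrix P"
    and \<pi>_stationary: "stationary_distribution P \<pi>"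
    and \<Lambda>_nonneg: "\<And>m i j. 0 \<le> \<Lambda> m $ i $ j"
    and \<Lambda>_sums: "\<Lambda> sums P"
    and kernel: "\<And>k i j m. 1 \<le> k \<Longrightarrow> \<P>(\<omega> in M. J (k - 1) \<omega> = i) > 0 \<Longrightarrow>
      \<P>(\<omega> in M. C k \<omega> = m \<and> J k \<omega> = j \<bar> J (k - 1) \<omega> = i) = \<Lambda> m $ i $ j"
    and conditional_independence: "\<And>k i j m js cs. 1 \<le> k \<Longrightarrow>
      \<P>(\<omega> in M. (C k \<omega> = m \<and> J k \<omega> = j) \<and>
                 ((\<forall>l<k. J l \<omega> = js l) \<and> (\<forall>l\<in>{1..<k}. C l \<omega> = cs l)) \<bar> J (k - 1) \<omega> = i) =
      \<P>(\<omega> in M. C k \<omega> = m \<and> J k \<omega> = j \<bar> J (k - 1) \<omega> = i) *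
      \<P>(\<omega> in M. (\<forall>l<k. J l \<omega> = js l) \<and> (\<forall>l\<in>{1..<k}. C l \<omega> = cs l) \<bar> J (k - 1) \<omega> = i)"
    and \<Lambda>0_pos: "\<And>i j. 0 < \<Lambda> 0 $ i $ j"
    and \<Lambda>0_invertible: "invertible (\<Lambda> 0)"

definition surplus :: "(nat \<Rightarrow> 'a \<Rightarrow> nat) \<Rightarrow> nat \<Rightarrow> 'a \<Rightarrow> int" where
  "surplus C n \<omega> = int n - (\<Sum>k=1..n. int (C k \<omega>))"

(* The infimum of the empty set in enat is \<infinity>; that of a nonempty set is its minimum. *)
definition ruin_time :: "(nat \<Rightarrow> 'a \<Rightarrow> nat) \<Rightarrow> 'a \<Rightarrow> enat" where
  "ruin_time C \<omega> = (INF n\<in>{n. 0 < n \<and> surplus C n \<omega> \<le> 0}. enat n)"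

definition ruin_matrix ::
  "'a measure \<Rightarrow> (nat \<Rightarrow> 'a \<Rightarrow> 'n) \<Rightarrow> (nat \<Rightarrow> 'a \<Rightarrow> nat) \<Rightarrow> nat \<Rightarrow> real^'n^'n" where
  "ruin_matrix M J C n =
     (\<chi> i j. \<P>(\<omega> in M. ruin_time C \<omega> = enat n \<and> J n \<omega> = j \<bar> J 0 \<omega> = i))"

section \<open>The matrices V(n, a)\<close>

(* D_kl, on real functions of the N^2 real variables R_kl; axis k (axis l 1) is the matrix
   unit E_kl. *)
definition partial :: "'n \<Rightarrow> 'n \<Rightarrow> (real^'n^'n \<Rightarrow> real) \<Rightarrow> real^'n^'n \<Rightarrow> real" where
  "partial k l f R = deriv (\<lambda>t. f (R + t *\<^sub>R axis k (axis l 1))) 0"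

(* The product over i, then over j, in increasing order, of the operators D_ij^(x_ij). The linear
   order on the index type only serves to order the factors. *)
definition iter_partial ::
  "('n::{finite,linorder} \<Rightarrow> 'n \<Rightarrow> nat) \<Rightarrow> ('n sqmat \<Rightarrow> real) \<Rightarrow> 'n sqmat \<Rightarrow> real" where
  "iter_partial x f =
     (let es = sorted_list_of_set (UNIV :: 'n set)
      in foldr (\<lambda>(i, j) g. (partial i j ^^ x i j) g) (List.product es es) f)"

(* The series converges in a neighbourhood of R = 0, which is all that the derivatives at 0 use;
   likewise the logarithm in Gamma_mat is applied to a positive number for R near 0, as its
   value at 0 is the positive entry of \<Lambda> 0. *)
definition Lambda_hat :: "(nat \<Rightarrow> real^'n^'n) \<Rightarrow> real^'n^'n \<Rightarrow> real^'n^'n" where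
  "Lambda_hat \<Lambda> R = (\<Sum>m. mat_pow R m ** \<Lambda> m)"

definition Gamma_mat ::
  "(nat \<Rightarrow> real^'n^'n) \<Rightarrow> real^'n^'n \<Rightarrow> real^('n \<times> 'n)^('n \<times> 'n)" where
  "Gamma_mat \<Lambda> R =
     (\<chi> p q. case (p, q) of ((i, j), (k, l)) \<Rightarrow>
        R $ i $ j * partial k l (\<lambda>S. ln (Lambda_hat \<Lambda> S $ i $ j)) R)"

definition C_mat ::
  "(nat \<Rightarrow> 'n sqmat) \<Rightarrow> ('n::{finite,linorder} \<Rightarrow> 'n \<Rightarrow> nat) \<Rightarrow> nat \<Rightarrow> 'n sqmat" where
  "C_mat \<Lambda> x a =
     (\<chi> u v. iter_partial x
        (\<lambda>R. mat_pow R a $ u $ v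
              * (\<Prod>i\<in>UNIV. \<Prod>j\<in>UNIV. (Lambda_hat \<Lambda> R $ i $ j) ^ x i j)
              * det (mat 1 - Gamma_mat \<Lambda> R)) 0)"

definition V_mat :: "(nat \<Rightarrow> 'n::{finite,linorder} sqmat) \<Rightarrow> nat \<Rightarrow> nat \<Rightarrow> 'n sqmat" where
  "V_mat \<Lambda> n a =
     (\<Sum>x\<in>{x :: 'n \<Rightarrow> 'n \<Rightarrow> nat. (\<Sum>i\<in>UNIV. \<Sum>j\<in>UNIV. x i j) = n}.
        (1 / (\<Prod>i\<in>UNIV. \<Prod>j\<in>UNIV. fact (x i j))) *\<^sub>R C_mat \<Lambda> x a)"

end

theory Submission
  imports Defs
begin

text \<open>
  Let \<open>W(n, a)\<close> be the matrix of the probabilities that the surplus is positive at the times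
  \<open>1, ..., n\<close> and equals \<open>a\<close> at time \<open>n\<close>, jointly with the states at times \<open>0\<close> and \<open>n\<close>. Ruin at time
  \<open>n\<close> means positivity up to time \<open>n - 1\<close> but not up to time \<open>n\<close>, so by the Markov property for
  \<open>n > 1\<close> its probability is \<open>(\<Sum>y. W(n - 1, y)) P - (\<Sum>y. W(n, y))\<close>, and it remains to see
  that \<open>W = V\<close>, given the initial state. As the surplus rises by at most one per step, conditioning
  on the last claim gives \<open>W(n + 1, a + 1) = (\<Sum>m. W(n, a + m) \<Lambda>(m))\<close>, where
  \<open>W(0, 0) = I\<close> and \<open>W(n, 0) = 0\<close> for \<open>n > 0\<close>. These relations determine \<open>W\<close>, and \<open>V\<close> satisfies them
  as well.

  The expression \<open>V(n, a)\<close> is the Lagrange-Good formula for the coefficient of \<open>v ^ n\<close> in the \<open>a\<close>-th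
  power of the solution of \<open>R = v (\<Sum>m. R ^ m \<Lambda>(m))\<close>. The inversion theorem itself can
  be bypassed. Write \<open>\<lambda>\<^sub>p\<close> for the entries of \<open>\<Sum>m. R ^ m \<Lambda>(m)\<close> and let \<open>L n f\<close> be the
  sum, over the exponents \<open>x\<close> of total degree \<open>n\<close>, of the coefficient of \<open>R ^ x\<close> in
  \<open>f \<lambda> ^ x |I - \<Gamma>|\<close>. A factor \<open>R\<^sub>p\<close> lowers the exponent, whence
  \<open>L (n + 1) (R\<^sub>p f) = L n (\<lambda>\<^sub>p f)\<close>, and for the entries of \<open>R ^ (a + 1) = R ^ a R\<close> this is the
  recurrence (\<open>V_mat_rec\<close>). The determinant matters only for the initial values, \<open>L n 1 = 0\<close> for
  \<open>n > 0\<close>: expanded into monomials row by row, every determinant that contributes to the coefficient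
  of \<open>R ^ x\<close> is annihilated by the row vector \<open>x\<close> (\<open>taylor_coeff_lagrange_det\<close>).

  The derivatives at the origin are taken of genuine functions, so the analytic part shows that the
  functions in question are sums of absolutely convergent power series on a polydisc and that
  iterated partial derivatives read off their coefficients. The reciprocals hidden in \<open>\<Gamma>\<close> are
  avoided: an operator that does not differentiate in the direction \<open>R\<^sub>p\<close> sees only the slice
  \<open>R\<^sub>p = 0\<close>, where row \<open>p\<close> of \<open>\<Gamma>\<close> vanishes, and in the other rows \<open>\<lambda>\<^sub>p ^ x\<^sub>p\<close> cancels the
  denominator.
\<close>

section \<open>Power series in the entries of a matrix\<close>

text \<open>
  The variables are the entries of a real matrix, indexed by pairs of states. The polydisc is open,
  so that its points have room for differentiation and derivatives do not cost radius.
\<close>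

definition polydisc :: "real \<Rightarrow> (real^'n^'n) set" where
  "polydisc r = {R. \<forall>i j. \<bar>R $ i $ j\<bar> < r}"

definition coord :: "'n \<times> 'n \<Rightarrow> real^'n^'n \<Rightarrow> real" where
  "coord p R = R $ fst p $ snd p"

definition monomial :: "real^'n^'n \<Rightarrow> ('n \<times> 'n \<Rightarrow> nat) \<Rightarrow> real" where
  "monomial R \<alpha> = (\<Prod>p\<in>UNIV. coord p R ^ \<alpha> p)"

text \<open>
  Unconditional summability over all exponents is what lets a series be regrouped freely: by the
  exponent of one variable when it is differentiated, by total exponent when series are multiplied.
\<close>

definition power_series :: "real \<Rightarrow> (('n \<times> 'n \<Rightarrow> nat) \<Rightarrow> real) \<Rightarrow> (real^'n^'n \<Rightarrow> real) \<Rightarrow> bool" where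
  "power_series r c f \<longleftrightarrow> (\<forall>R\<in>polydisc r. ((\<lambda>\<alpha>. c \<alpha> * monomial R \<alpha>) has_sum f R) UNIV)"

definition polydisc_analytic :: "real \<Rightarrow> (real^'n^'n \<Rightarrow> real) \<Rightarrow> bool" where
  "polydisc_analytic r f \<longleftrightarrow> (\<exists>c. power_series r c f)"

lemma power_seriesD:
  "power_series r c f \<Longrightarrow> R \<in> polydisc r \<Longrightarrow> ((\<lambda>\<alpha>. c \<alpha> * monomial R \<alpha>) has_sum f R) UNIV"
  by (auto simp: power_series_def)

lemma monomial_add: "monomial R (\<lambda>p. \<alpha> p + \<beta> p) = monomial R \<alpha> * monomial R \<beta>"
  by (simp add: monomial_def power_add prod.distrib)

lemma monomial_0: "monomial R (\<lambda>p. 0) = 1"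
  by (simp add: monomial_def)

lemma monomial_sum: "monomial R (\<lambda>q. \<Sum>p\<in>S. A p q) = (\<Prod>p\<in>S. monomial R (A p))"
  by (induction S rule: infinite_finite_induct) (simp_all add: monomial_0 monomial_add)

lemma monomial_update:
  "monomial R (\<alpha>(p := n)) = coord p R ^ n * monomial R (\<alpha>(p := 0))"
proof -
  have "monomial R (\<alpha>(p := n)) = coord p R ^ n * (\<Prod>q\<in>UNIV-{p}. coord q R ^ \<alpha> q)" for n
    unfolding monomial_def by (subst prod.remove[of _ p]) (auto intro!: prod.cong)
  from this[of n] this[of 0] show ?thesis by simp
qed

lemma monomial_zero: "monomial 0 \<alpha> = (if \<alpha> = (\<lambda>p. 0) then 1 else 0)"
proof (cases "\<alpha> = (\<lambda>p. 0)")
  case False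
  then obtain p where "\<alpha> p \<noteq> 0" by (auto simp: fun_eq_iff)
  then have "(0::real) ^ \<alpha> p = 0" by simp
  then show ?thesis using False
    unfolding monomial_def coord_def zero_index by (metis (mono_tags, lifting) UNIV_I finite prod_zero)
qed (simp add: monomial_0)

lemma monomial_abs: "\<bar>monomial R \<alpha>\<bar> = monomial (\<chi> i j. \<bar>R $ i $ j\<bar>) \<alpha>"
  by (simp add: monomial_def abs_prod coord_def power_abs)

lemma zero_in_polydisc: "0 < r \<Longrightarrow> 0 \<in> polydisc r"
  by (simp add: polydisc_def)

lemma polydisc_abs: "R \<in> polydisc r \<Longrightarrow> (\<chi> i j. \<bar>R $ i $ j\<bar>) \<in> polydisc r"
  by (simp add: polydisc_def)

lemma polydisc_analyticI: "power_series r c f \<Longrightarrow> polydisc_analytic r f"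
  by (auto simp: polydisc_analytic_def)

text \<open>
  Collects like monomials. Products of series and multiplication by a variable produce index sets
  other than the exponents themselves; this turns such an expansion into a genuine power series.
\<close>

lemma power_series_regroup:
  fixes g :: "'b \<Rightarrow> 'n::finite \<times> 'n \<Rightarrow> nat"
  assumes sum: "\<And>R. R \<in> polydisc r \<Longrightarrow> ((\<lambda>i. c i * monomial R (g i)) has_sum f R) I"
    and fin: "\<And>\<gamma>. finite {i\<in>I. g i = \<gamma>}"
  shows "power_series r (\<lambda>\<gamma>. \<Sum>i\<in>{i\<in>I. g i = \<gamma>}. c i) f"
  unfolding power_series_def
proof
  fix R :: "real^'n^'n" assume R: "R \<in> polydisc r"
  have "((\<lambda>(\<gamma>,i). c i * monomial R (g i)) has_sum f R) (SIGMA \<gamma>:UNIV. {i\<in>I. g i = \<gamma>})"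
    by (rule iffD1[OF has_sum_reindex_bij_witness[of _ snd "\<lambda>i. (g i, i)"] sum[OF R]]) auto
  then show "((\<lambda>\<alpha>. (\<Sum>i\<in>{i\<in>I. g i = \<alpha>}. c i) * monomial R \<alpha>) has_sum f R) UNIV"
    by (rule has_sum_SigmaD) (auto simp: sum_distrib_right fin intro!: has_sum_finiteI sum.cong)
qed

lemma power_series_cong:
  "power_series r c f \<Longrightarrow> (\<And>R. R \<in> polydisc r \<Longrightarrow> f R = g R) \<Longrightarrow> power_series r c g"
  by (auto simp: power_series_def)

lemma power_series_const:
  "power_series r (\<lambda>\<alpha>. if \<alpha> = (\<lambda>p. 0) then a else 0) (\<lambda>R. a)"
  unfolding power_series_def
  by (intro ballI has_sum_finite_neutralI[of "{\<lambda>p. 0}"]) (auto simp: monomial_0 split: if_splits)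

lemma power_series_add:
  "power_series r c f \<Longrightarrow> power_series r d g \<Longrightarrow> power_series r (\<lambda>\<alpha>. c \<alpha> + d \<alpha>) (\<lambda>R. f R + g R)"
  by (auto simp: power_series_def distrib_right intro!: has_sum_add)

lemma power_series_cmult:
  "power_series r c f \<Longrightarrow> power_series r (\<lambda>\<alpha>. a * c \<alpha>) (\<lambda>R. a * f R)"
  by (auto simp: power_series_def mult.assoc intro!: has_sum_cmult_right)

lemma power_series_sum:
  "finite I \<Longrightarrow> (\<And>i. i \<in> I \<Longrightarrow> power_series r (c i) (f i)) \<Longrightarrow>
   power_series r (\<lambda>\<alpha>. \<Sum>i\<in>I. c i \<alpha>) (\<lambda>R. \<Sum>i\<in>I. f i R)"
  by (induction I rule: finite_induct)
     (use power_series_const[of r 0] in \<open>auto intro: power_series_add\<close>)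

text \<open>
  The coefficients are needed explicitly: the vanishing of the Lagrange determinant is read off term
  by term from the families \<open>A\<close> of exponents, one for each factor, that add up to a given exponent.
\<close>

lemma power_series_prod:
  fixes f :: "'p::finite \<Rightarrow> real^'n^'n \<Rightarrow> real"
  assumes ps: "\<And>p. power_series r (c p) (f p)"
  shows "power_series r (\<lambda>\<gamma>. \<Sum>A\<in>{A. (\<lambda>q. \<Sum>p\<in>UNIV. A p q) = \<gamma>}. \<Prod>p\<in>UNIV. c p (A p))
           (\<lambda>R. \<Prod>p\<in>UNIV. f p R)"
proof -
  have "finite {A :: 'p \<Rightarrow> 'n \<times> 'n \<Rightarrow> nat. (\<lambda>q. \<Sum>p\<in>UNIV. A p q) = \<gamma>}" for \<gamma>
  proof (rule finite_subset)
    show "{A :: 'p \<Rightarrow> 'n \<times> 'n \<Rightarrow> nat. (\<lambda>q. \<Sum>p\<in>UNIV. A p q) = \<gamma>}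
       \<subseteq> PiE UNIV (\<lambda>_. PiE UNIV (\<lambda>q. {..\<gamma> q}))"
      by (auto simp: PiE_UNIV_domain intro!: member_le_sum)
    show "finite (PiE (UNIV :: 'p set) (\<lambda>_. PiE (UNIV :: ('n \<times> 'n) set) (\<lambda>q. {..\<gamma> q})))"
      by (intro finite_PiE) auto
  qed
  moreover have "((\<lambda>A. (\<Prod>p\<in>UNIV. c p (A p)) * monomial R (\<lambda>q. \<Sum>p\<in>UNIV. A p q)) has_sum (\<Prod>p\<in>UNIV. f p R)) UNIV"
    if R: "R \<in> polydisc r" for R
  proof -
    let ?t = "\<lambda>p \<alpha>. c p \<alpha> * monomial R \<alpha>"
    have t: "(?t p has_sum f p R) UNIV" for p
      using power_seriesD[OF ps R] .
    have abs: "(\<lambda>\<alpha>. norm (?t p \<alpha>)) summable_on UNIV" for p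
      by (rule summable_on_iff_abs_summable_on_real[THEN iffD1, OF has_sum_imp_summable[OF t]])
    have "Infinite_Set_Sum.abs_summable_on (\<lambda>A. \<Prod>p\<in>UNIV. ?t p (A p)) (PiE UNIV (\<lambda>_. UNIV))"
      by (rule abs_summable_on_prod_PiE) (use abs in \<open>auto simp: abs_summable_equivalent[symmetric]\<close>)
    then have "(\<lambda>A. norm (\<Prod>p\<in>UNIV. ?t p (A p))) summable_on (PiE UNIV (\<lambda>_. UNIV))"
      unfolding abs_summable_equivalent[symmetric] .
    then have "(\<lambda>A. \<Prod>p\<in>UNIV. ?t p (A p)) summable_on UNIV"
      using abs_summable_summable[of "\<lambda>A. \<Prod>p\<in>UNIV. ?t p (A p)" "PiE UNIV (\<lambda>_. UNIV)"]
      by (simp only: PiE_UNIV_domain UNIV_I simp_thms Collect_const if_True Pi_UNIV)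
    moreover have "infsum (\<lambda>A. \<Prod>p\<in>UNIV. ?t p (A p)) (PiE UNIV (\<lambda>_. UNIV)) = (\<Prod>p\<in>UNIV. infsum (?t p) UNIV)"
      by (rule infsum_prod_PiE_abs) (use abs in auto)
    ultimately have "((\<lambda>A. \<Prod>p\<in>UNIV. ?t p (A p)) has_sum (\<Prod>p\<in>UNIV. f p R)) UNIV"
      using infsumI[OF t] by (simp add: has_sum_iff PiE_UNIV_domain)
    then show ?thesis
      by (simp add: monomial_sum prod.distrib)
  qed
  ultimately show ?thesis
    using power_series_regroup[where g = "\<lambda>A q. \<Sum>p\<in>UNIV. A p q" and I = UNIV
        and c = "\<lambda>A. \<Prod>p\<in>UNIV. c p (A p)" and f = "\<lambda>R. \<Prod>p\<in>UNIV. f p R" and r = r] by simp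
qed

lemma polydisc_analytic_const: "polydisc_analytic r (\<lambda>R. a)"
  by (rule polydisc_analyticI[OF power_series_const])

lemma polydisc_analytic_add:
  "polydisc_analytic r f \<Longrightarrow> polydisc_analytic r g \<Longrightarrow> polydisc_analytic r (\<lambda>R. f R + g R)"
  unfolding polydisc_analytic_def using power_series_add by blast

lemma polydisc_analytic_cmult: "polydisc_analytic r f \<Longrightarrow> polydisc_analytic r (\<lambda>R. a * f R)"
  unfolding polydisc_analytic_def using power_series_cmult by blast

lemma polydisc_analytic_sum:
  "finite I \<Longrightarrow> (\<And>i. i \<in> I \<Longrightarrow> polydisc_analytic r (f i)) \<Longrightarrow> polydisc_analytic r (\<lambda>R. \<Sum>i\<in>I. f i R)"
  by (induction I rule: finite_induct) (auto intro: polydisc_analytic_const polydisc_analytic_add)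

lemma polydisc_analytic_mult:
  assumes "polydisc_analytic r f" "polydisc_analytic r g"
  shows "polydisc_analytic r (\<lambda>R. f R * g R)"
proof -
  obtain c d where "power_series r c f" "power_series r d g"
    using assms by (auto simp: polydisc_analytic_def)
  then have "power_series r (\<lambda>\<gamma>. \<Sum>A\<in>{A. (\<lambda>q. \<Sum>p\<in>UNIV. A p q) = \<gamma>}.
      \<Prod>b\<in>UNIV. (if b then c else d) (A b)) (\<lambda>R. \<Prod>b\<in>UNIV. (if b then f else g) R)"
    by (intro power_series_prod[where c = "\<lambda>b. if b then c else d" and f = "\<lambda>b. if b then f else g"]) simp
  then have "polydisc_analytic r (\<lambda>R. \<Prod>b\<in>UNIV. (if b then f else g) R)"
    by (rule polydisc_analyticI)
  moreover have "(\<lambda>R. \<Prod>b\<in>UNIV. (if b then f else g) R) = (\<lambda>R. f R * g R)"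
    by (simp add: UNIV_bool mult.commute)
  ultimately show ?thesis
    by simp
qed

lemma polydisc_analytic_prod:
  "finite I \<Longrightarrow> (\<And>i. i \<in> I \<Longrightarrow> polydisc_analytic r (f i)) \<Longrightarrow> polydisc_analytic r (\<lambda>R. \<Prod>i\<in>I. f i R)"
  by (induction I rule: finite_induct) (auto intro: polydisc_analytic_const polydisc_analytic_mult)

lemma polydisc_analytic_power: "polydisc_analytic r f \<Longrightarrow> polydisc_analytic r (\<lambda>R. f R ^ n)"
  by (induction n) (auto intro: polydisc_analytic_const polydisc_analytic_mult)

lemma power_series_coord_mult:
  fixes p :: "'n::finite \<times> 'n"
  assumes "power_series r c f"
  shows "power_series r (\<lambda>\<alpha>. if \<alpha> p = 0 then 0 else c (\<alpha>(p := \<alpha> p - 1))) (\<lambda>R. coord p R * f R)"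
  unfolding power_series_def
proof
  fix R :: "real^'n^'n" assume R: "R \<in> polydisc r"
  let ?S = "{\<alpha> :: 'n \<times> 'n \<Rightarrow> nat. \<alpha> p \<noteq> 0}"
  have "((\<lambda>\<alpha>. coord p R * (c \<alpha> * monomial R \<alpha>)) has_sum (coord p R * f R)) UNIV"
    by (rule has_sum_cmult_right) (rule power_seriesD[OF assms R])
  then have shifted: "((\<lambda>\<alpha>. coord p R * (c (\<alpha>(p := \<alpha> p - 1)) * monomial R (\<alpha>(p := \<alpha> p - 1))))
      has_sum (coord p R * f R)) ?S"
    by (rule iffD2[OF has_sum_reindex_bij_betw[of "\<lambda>\<alpha>. \<alpha>(p := \<alpha> p - 1)" ?S UNIV
        "\<lambda>\<alpha>. coord p R * (c \<alpha> * monomial R \<alpha>)"], rotated])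
       (rule bij_betwI[where g = "\<lambda>\<alpha>. \<alpha>(p := Suc (\<alpha> p))"], simp_all)
  have eq: "monomial R \<alpha> = coord p R * monomial R (\<alpha>(p := \<alpha> p - 1))" if \<alpha>: "\<alpha> \<in> ?S" for \<alpha>
  proof -
    obtain k where k: "\<alpha> p = Suc k" using \<alpha> by (cases "\<alpha> p") simp_all
    have "monomial R \<alpha> = coord p R ^ Suc k * monomial R (\<alpha>(p := 0))"
      using monomial_update[of R \<alpha> p "Suc k"] k by (metis fun_upd_triv)
    then show ?thesis
      using monomial_update[of R \<alpha> p k] by (simp only: k power_Suc mult.assoc diff_Suc_1)
  qed
  have terms: "coord p R * (c (\<alpha>(p := \<alpha> p - 1)) * monomial R (\<alpha>(p := \<alpha> p - 1))) =
      c (\<alpha>(p := \<alpha> p - 1)) * monomial R \<alpha>" if "\<alpha> \<in> ?S" for \<alpha>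
    using eq[OF that] by (simp only: mult.left_commute)
  have "((\<lambda>\<alpha>. c (\<alpha>(p := \<alpha> p - 1)) * monomial R \<alpha>) has_sum (coord p R * f R)) ?S"
    by (rule iffD1[OF has_sum_cong shifted]) (rule terms)
  then show "((\<lambda>\<alpha>. (if \<alpha> p = 0 then 0 else c (\<alpha>(p := \<alpha> p - 1))) * monomial R \<alpha>) has_sum (coord p R * f R)) UNIV"
    by (rule iffD1[OF has_sum_cong_neutral, rotated -1]) simp_all
qed

lemma polydisc_analytic_coord: "polydisc_analytic r (coord p)"
  using power_series_coord_mult[OF power_series_const[of r 1], of p] polydisc_analyticI by fastforce

lemma polydisc_analytic_det:
  fixes A :: "real^'n^'n \<Rightarrow> real^'m^'m"
  assumes "\<And>i j. polydisc_analytic r (\<lambda>R. A R $ i $ j)"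
  shows "polydisc_analytic r (\<lambda>R. det (A R))"
  unfolding det_def
  by (intro polydisc_analytic_sum polydisc_analytic_cmult polydisc_analytic_prod assms) (simp_all add: finite_permutations)

section \<open>Partial derivatives of power series\<close>

lemma coord_shift:
  "coord q (R + t *\<^sub>R axis k (axis l 1)) = coord q R + (if q = (k, l) then t else 0)"
  by (cases q) (simp add: coord_def axis_def)

lemma monomial_shift:
  fixes R :: "real^'n^'n" and k l :: 'n
  shows "monomial (R + t *\<^sub>R axis k (axis l 1)) \<alpha>
    = (coord (k, l) R + t) ^ \<alpha> (k, l) * monomial R (\<alpha>((k, l) := 0))"
proof -
  have "monomial (R + t *\<^sub>R axis k (axis l 1)) (\<alpha>((k, l) := \<alpha> (k, l)))
    = coord (k, l) (R + t *\<^sub>R axis k (axis l 1)) ^ \<alpha> (k, l)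
      * monomial (R + t *\<^sub>R axis k (axis l 1)) (\<alpha>((k, l) := 0))"
    by (rule monomial_update)
  moreover have "monomial (R + t *\<^sub>R axis k (axis l 1)) (\<alpha>((k, l) := 0)) = monomial R (\<alpha>((k, l) := 0))"
    unfolding monomial_def coord_shift by (intro prod.cong) auto
  ultimately show ?thesis
    by (simp add: coord_shift)
qed

lemma polydisc_shift:
  assumes "R \<in> polydisc r" "\<bar>coord (k, l) R + t\<bar> < r"
  shows "R + t *\<^sub>R axis k (axis l 1) \<in> polydisc r"
  using assms coord_shift[of "(i, j)" R t k l for i j] by (auto simp: polydisc_def coord_def split: if_splits)

lemma eventually_polydisc_shift:
  assumes "R \<in> polydisc r"
  shows "eventually (\<lambda>t. R + t *\<^sub>R axis k (axis l 1) \<in> polydisc r) (nhds 0)"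
proof -
  have "((\<lambda>t. \<bar>coord (k, l) R + t\<bar>) \<longlongrightarrow> \<bar>coord (k, l) R + 0\<bar>) (nhds 0)"
    by (intro tendsto_intros filterlim_ident)
  moreover have "\<bar>coord (k, l) R + 0\<bar> < r"
    using assms by (simp add: polydisc_def coord_def)
  ultimately have "eventually (\<lambda>t. \<bar>coord (k, l) R + t\<bar> < r) (nhds 0)"
    by (rule order_tendstoD(2))
  then show ?thesis
    by eventually_elim (rule polydisc_shift[OF assms])
qed

text \<open>
  Grouped by the exponent \<open>n\<close> of the variable that moves, the series becomes a power series in that
  variable alone, which may be differentiated termwise. The majorant with absolute values has the
  same shape, and this gives the joint summability that is needed to ungroup the derivative.
\<close>

lemma power_series_has_derivative:
  fixes R :: "real^'n^'n" and k l :: 'n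
  assumes ps: "power_series r c f" and R: "R \<in> polydisc r"
  obtains D where
    "((\<lambda>t. f (R + t *\<^sub>R axis k (axis l 1))) has_field_derivative D) (at 0)"
    "((\<lambda>\<alpha>. real (Suc (\<alpha> (k, l))) * c (\<alpha>((k, l) := Suc (\<alpha> (k, l)))) * monomial R \<alpha>) has_sum D) UNIV"
proof -
  define p where "p = (k, l)"
  define s where "s = coord p R"
  \<comment> \<open>Every exponent is \<open>\<beta>(p := n)\<close> for a unique pair \<open>(n, \<beta>)\<close> with \<open>\<beta> p = 0\<close>.\<close>
  define Z where "Z = {\<beta> :: 'n \<times> 'n \<Rightarrow> nat. \<beta> p = 0}"
  define a where "a n \<beta> = c (\<beta>(p := n)) * monomial R \<beta>" for n \<beta>
  define F where "F t = f (R + (t - s) *\<^sub>R axis k (axis l 1))" for t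
  have s: "\<bar>s\<bar> < r" using R by (simp add: s_def p_def polydisc_def coord_def)
  have bij: "bij_betw (\<lambda>(n, \<beta>). \<beta>(p := n)) (UNIV \<times> Z) UNIV"
    by (rule bij_betwI[where g = "\<lambda>\<alpha>. (\<alpha> p, \<alpha>(p := 0))"]) (auto simp: Z_def)
  have expand: "((\<lambda>(n, \<beta>). a n \<beta> * t ^ n) has_sum F t) (UNIV \<times> Z)" if "\<bar>t\<bar> < r" for t
  proof -
    have "R + (t - s) *\<^sub>R axis k (axis l 1) \<in> polydisc r"
      by (rule polydisc_shift[OF R]) (use that in \<open>simp add: s_def p_def\<close>)
    from power_seriesD[OF ps this]
    have "((\<lambda>\<alpha>. c \<alpha> * (t ^ \<alpha> p * monomial R (\<alpha>(p := 0)))) has_sum F t) UNIV"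
      unfolding monomial_shift F_def s_def p_def by simp
    then have "((\<lambda>x. c ((case x of (n, \<beta>) \<Rightarrow> \<beta>(p := n))) * (t ^ (case x of (n, \<beta>) \<Rightarrow> \<beta>(p := n)) p *
        monomial R ((case x of (n, \<beta>) \<Rightarrow> \<beta>(p := n))(p := 0)))) has_sum F t) (UNIV \<times> Z)"
      by (rule iffD2[OF has_sum_reindex_bij_betw[OF bij]])
    then show ?thesis
      by (rule iffD1[OF has_sum_cong, rotated]) (auto simp: a_def Z_def fun_upd_idem)
  qed
  have r: "r > 0" using s by linarith
  have summ_abs: "(\<lambda>(n, \<beta>). \<bar>a n \<beta>\<bar> * t ^ n) summable_on (UNIV \<times> Z)" if "0 \<le> t" "t < r" for t
  proof -
    have "(\<lambda>x. norm (case x of (n, \<beta>) \<Rightarrow> a n \<beta> * t ^ n)) summable_on (UNIV \<times> Z)"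
      by (rule iffD1[OF summable_on_iff_abs_summable_on_real has_sum_imp_summable[OF expand]]) (use that in auto)
    then show ?thesis
      by (rule iffD1[OF summable_on_cong, rotated]) (use that in \<open>auto simp: abs_mult\<close>)
  qed
  have inner_abs: "(\<lambda>\<beta>. \<bar>a n \<beta>\<bar>) summable_on Z" for n
  proof -
    have "(\<lambda>\<beta>. \<bar>a n \<beta>\<bar> * (r/2) ^ n) summable_on Z"
      by (rule summable_on_SigmaD1[OF summ_abs]) (use r in auto)
    then show ?thesis
      using r by (simp add: summable_on_cmult_left' del: summable_on_cmult_left)
  qed
  have inner: "a n summable_on Z" for n
    using inner_abs[of n] summable_on_iff_abs_summable_on_real by (metis (mono_tags, lifting) real_norm_def summable_on_cong)
  define b where "b n = infsum (a n) Z" for n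
  define B where "B n = infsum (\<lambda>\<beta>. \<bar>a n \<beta>\<bar>) Z" for n
  have b: "(a n has_sum b n) Z" for n
    unfolding b_def by (rule has_sum_infsum[OF inner])
  have B: "((\<lambda>\<beta>. \<bar>a n \<beta>\<bar>) has_sum B n) Z" for n
    unfolding B_def by (rule has_sum_infsum[OF inner_abs])
  have Fsum: "(\<lambda>n. b n * t ^ n) sums F t" if "\<bar>t\<bar> < r" for t
    by (rule has_sum_imp_sums, rule has_sum_SigmaD[OF expand[OF that]])
       (auto intro: has_sum_cmult_left b)
  have Bsum: "summable (\<lambda>n. B n * t ^ n)" if "\<bar>t\<bar> < r" for t
  proof -
    have "((\<lambda>n. B n * \<bar>t\<bar> ^ n) has_sum infsum (\<lambda>(n, \<beta>). \<bar>a n \<beta>\<bar> * \<bar>t\<bar> ^ n) (UNIV \<times> Z)) UNIV"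
      by (rule has_sum_SigmaD[OF has_sum_infsum[OF summ_abs[of "\<bar>t\<bar>"]]])
         (use that in \<open>auto intro: has_sum_cmult_left B\<close>)
    then have "summable (\<lambda>n. B n * \<bar>t\<bar> ^ n)"
      using has_sum_imp_sums sums_summable by blast
    moreover have "0 \<le> B n" for n
      unfolding B_def by (simp add: infsum_nonneg)
    ultimately show ?thesis
      by (intro summable_norm_cancel[of "\<lambda>n. B n * t ^ n"]) (simp add: abs_mult power_abs)
  qed
  define D where "D = (\<Sum>n. diffs b n * s ^ n)"
  have "(F has_field_derivative D) (at s)"
  proof -
    have series: "((\<lambda>t. \<Sum>n. b n * t ^ n) has_field_derivative D) (at s)"
      unfolding D_def by (rule termdiffs_strong'[where K = r]) (use s Fsum sums_summable in auto)
    have ev: "eventually (\<lambda>t. (\<Sum>n. b n * t ^ n) = F t) (nhds s)"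
    proof -
      have "eventually (\<lambda>t. t \<in> {-r<..<r}) (nhds s)"
        by (rule eventually_nhds_in_open) (use s in auto)
      then show ?thesis
        by eventually_elim (use Fsum sums_unique in \<open>fastforce simp: abs_less_iff\<close>)
    qed
    show ?thesis
      by (rule iffD1[OF DERIV_cong_ev[OF refl ev refl] series])
  qed
  then have "((\<lambda>t. F (s + t)) has_field_derivative D) (at 0)"
    using DERIV_shift[of F D 0 s] by (simp add: add.commute)
  then have 1: "((\<lambda>t. f (R + t *\<^sub>R axis k (axis l 1))) has_field_derivative D) (at 0)"
    by (simp add: F_def)
  define d where "d = (\<lambda>(n, \<beta>). real (Suc n) * a (Suc n) \<beta> * s ^ n)"
  have dB: "summable (\<lambda>n. diffs B n * \<bar>s\<bar> ^ n)"
    by (rule termdiff_converges[where K = r]) (use s Bsum in auto)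
  have d_summable: "d summable_on (UNIV \<times> Z)"
  proof (rule iffD2[OF summable_on_iff_abs_summable_on_real], rule summable_on_SigmaI)
    show "((\<lambda>y. norm (d (n, y))) has_sum diffs B n * \<bar>s\<bar> ^ n) Z" for n
    proof -
      have "((\<lambda>y. (real (Suc n) * \<bar>s\<bar> ^ n) * \<bar>a (Suc n) y\<bar>) has_sum (real (Suc n) * \<bar>s\<bar> ^ n) * B (Suc n)) Z"
        by (rule has_sum_cmult_right[OF B])
      then show ?thesis
        by (simp add: d_def diffs_def abs_mult power_abs mult_ac)
    qed
    have "0 \<le> B n" for n
      unfolding B_def by (simp add: infsum_nonneg)
    then show "(\<lambda>n. diffs B n * \<bar>s\<bar> ^ n) summable_on UNIV"
      using dB by (subst summable_on_UNIV_nonneg_real_iff) (auto simp: diffs_def)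
  qed auto
  then have dsum: "(d has_sum infsum d (UNIV \<times> Z)) (UNIV \<times> Z)"
    by (rule has_sum_infsum)
  have "((\<lambda>n. diffs b n * s ^ n) has_sum infsum d (UNIV \<times> Z)) UNIV"
  proof (rule has_sum_SigmaD[OF dsum])
    show "((\<lambda>y. d (n, y)) has_sum diffs b n * s ^ n) Z" for n
    proof -
      have "((\<lambda>y. (real (Suc n) * s ^ n) * a (Suc n) y) has_sum (real (Suc n) * s ^ n) * b (Suc n)) Z"
        by (rule has_sum_cmult_right[OF b])
      then show ?thesis
        by (simp add: d_def diffs_def mult_ac)
    qed
  qed
  then have "infsum d (UNIV \<times> Z) = D"
    unfolding D_def using has_sum_imp_sums sums_unique by blast
  with dsum have dD: "(d has_sum D) (UNIV \<times> Z)"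
    by simp
  have "((\<lambda>\<alpha>. real (Suc (\<alpha> p)) * c (\<alpha>(p := Suc (\<alpha> p))) * monomial R \<alpha>) has_sum D) UNIV"
  proof (rule iffD1[OF has_sum_reindex_bij_betw[OF bij]], rule iffD1[OF has_sum_cong dD])
    fix x :: "nat \<times> ('n \<times> 'n \<Rightarrow> nat)"
    obtain n \<beta> where x: "x = (n, \<beta>)" by (cases x)
    assume "x \<in> UNIV \<times> Z"
    then have "\<beta>(p := 0) = \<beta>" by (simp add: x Z_def fun_upd_idem)
    then have "monomial R (\<beta>(p := n)) = s ^ n * monomial R \<beta>"
      using monomial_update[of R \<beta> p n] by (simp add: s_def)
    then show "d x = real (Suc ((case x of (n, \<beta>) \<Rightarrow> \<beta>(p := n)) p)) *
        c ((case x of (n, \<beta>) \<Rightarrow> \<beta>(p := n))(p := Suc ((case x of (n, \<beta>) \<Rightarrow> \<beta>(p := n)) p))) *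
        monomial R (case x of (n, \<beta>) \<Rightarrow> \<beta>(p := n))"
      by (simp add: x d_def a_def mult_ac)
  qed
  with 1 show ?thesis
    using that by (simp add: p_def)
qed

lemma power_series_partial:
  fixes k l :: "'n::finite"
  assumes "power_series r c f"
  shows "power_series r (\<lambda>\<alpha>. real (Suc (\<alpha> (k, l))) * c (\<alpha>((k, l) := Suc (\<alpha> (k, l))))) (partial k l f)"
  unfolding power_series_def
proof
  fix R :: "real^'n^'n" assume R: "R \<in> polydisc r"
  show "((\<lambda>\<alpha>. real (Suc (\<alpha> (k, l))) * c (\<alpha>((k, l) := Suc (\<alpha> (k, l)))) * monomial R \<alpha>)
     has_sum partial k l f R) UNIV"
    by (rule power_series_has_derivative[OF assms R, of k l]) (simp add: partial_def DERIV_imp_deriv)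
qed

lemma polydisc_analytic_has_partial:
  assumes "polydisc_analytic r f" "R \<in> polydisc r"
  shows "((\<lambda>t. f (R + t *\<^sub>R axis k (axis l 1))) has_field_derivative partial k l f R) (at 0)"
proof -
  obtain c where c: "power_series r c f" using assms(1) by (auto simp: polydisc_analytic_def)
  show ?thesis
  proof (rule power_series_has_derivative[OF c assms(2), of k l])
    fix D assume D: "((\<lambda>t. f (R + t *\<^sub>R axis k (axis l 1))) has_field_derivative D) (at 0)"
    then have "partial k l f R = D" unfolding partial_def by (rule DERIV_imp_deriv)
    with D show ?thesis by simp
  qed
qed

lemma polydisc_analytic_partial: "polydisc_analytic r f \<Longrightarrow> polydisc_analytic r (partial k l f)"
  unfolding polydisc_analytic_def by (auto intro: power_series_partial)

section \<open>Taylor coefficients at the origin\<close>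

lemma power_series_at_0:
  assumes "0 < r" "power_series r c f"
  shows "f 0 = c (\<lambda>p. 0)"
proof -
  have "((\<lambda>\<alpha>. c \<alpha> * monomial 0 \<alpha>) has_sum f 0) UNIV"
    by (rule power_seriesD[OF assms(2) zero_in_polydisc[OF assms(1)]])
  moreover have "((\<lambda>\<alpha>. c \<alpha> * monomial 0 \<alpha>) has_sum c (\<lambda>p. 0)) UNIV"
    by (rule has_sum_finite_neutralI[of "{\<lambda>p. 0}"]) (auto simp: monomial_zero split: if_splits)
  ultimately show ?thesis
    by (rule has_sum_unique)
qed

lemma power_series_partial_funpow:
  fixes k l :: "'n::finite"
  assumes "power_series r c f"
  shows "power_series r (\<lambda>\<alpha>. fact (\<alpha> (k, l) + n) / fact (\<alpha> (k, l)) * c (\<alpha>((k, l) := \<alpha> (k, l) + n)))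
    ((partial k l ^^ n) f)"
proof (induction n)
  case 0
  show ?case using assms by simp
next
  case (Suc n)
  have "real (Suc a) * (fact (Suc a + n) / fact (Suc a) * y) = fact (a + Suc n) / fact a * y" for a y
    by (simp add: field_simps del: of_nat_Suc)
  with power_series_partial[OF Suc, of k l] show ?case
    by (simp del: of_nat_Suc fact_Suc cong: if_cong)
qed

text \<open>
  On a list of distinct variables each operator shifts a different component of the exponent, so the
  factors do not interact and their order does not matter.
\<close>

lemma power_series_foldr_partial:
  fixes ps :: "('n::finite \<times> 'n) list"
  assumes "distinct ps" and f: "power_series r c f"
  shows "power_series r
     (\<lambda>\<alpha>. (\<Prod>q\<in>set ps. fact (\<alpha> q + x q) / fact (\<alpha> q))
           * c (\<lambda>q. if q \<in> set ps then \<alpha> q + x q else \<alpha> q))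
     (foldr (\<lambda>(i, j) g. (partial i j ^^ x (i, j)) g) ps f)"
  using assms(1)
proof (induction ps)
  case Nil
  show ?case using f by simp
next
  case (Cons p ps)
  obtain k l where p: "p = (k, l)" by (cases p)
  define u where "u \<alpha> = \<alpha>(p := \<alpha> p + x p)" for \<alpha> :: "'n \<times> 'n \<Rightarrow> nat"
  have nin: "p \<notin> set ps" and ps: "distinct ps" using Cons.prems by auto
  have 1: "(\<Prod>q\<in>set ps. fact (u \<alpha> q + x q) / fact (u \<alpha> q)) =
      (\<Prod>q\<in>set ps. fact (\<alpha> q + x q) / fact (\<alpha> q) :: real)" for \<alpha>
    by (intro prod.cong) (use nin in \<open>auto simp: u_def\<close>)
  have 2: "(\<lambda>q. if q \<in> set ps then u \<alpha> q + x q else u \<alpha> q) =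
      (\<lambda>q. if q \<in> set (p # ps) then \<alpha> q + x q else \<alpha> q)" for \<alpha>
    using nin by (auto simp: u_def)
  have "power_series r
     (\<lambda>\<alpha>. fact (\<alpha> p + x p) / fact (\<alpha> p) * ((\<Prod>q\<in>set ps. fact (u \<alpha> q + x q) / fact (u \<alpha> q))
           * c (\<lambda>q. if q \<in> set ps then u \<alpha> q + x q else u \<alpha> q)))
     (foldr (\<lambda>(i, j) g. (partial i j ^^ x (i, j)) g) (p # ps) f)"
    using power_series_partial_funpow[OF Cons.IH[OF ps], of k l "x p"]
    unfolding u_def p by simp
  then show ?case
    unfolding 1 2 using nin by (simp add: mult.assoc)
qed

definition taylor_coeff ::
    "('n \<times> 'n \<Rightarrow> nat) \<Rightarrow> ('n::{finite,linorder} sqmat \<Rightarrow> real) \<Rightarrow> real" where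
  "taylor_coeff x f = iter_partial (curry x) f 0 / (\<Prod>p\<in>UNIV. fact (x p))"

lemma iter_partial_foldr:
  fixes x :: "'n::{finite,linorder} \<times> 'n \<Rightarrow> nat"
  obtains ps where "distinct ps" "set ps = UNIV"
    "\<And>f. iter_partial (curry x) f = foldr (\<lambda>(i, j) g. (partial i j ^^ x (i, j)) g) ps f"
proof
  let ?es = "sorted_list_of_set (UNIV :: 'n set)"
  show "distinct (List.product ?es ?es)" "set (List.product ?es ?es) = UNIV"
    by (auto simp: distinct_product)
  show "iter_partial (curry x) f =
      foldr (\<lambda>(i, j) g. (partial i j ^^ x (i, j)) g) (List.product ?es ?es) f" for f
    by (simp add: iter_partial_def Let_def curry_def)
qed

lemma taylor_coeff_eq:
  assumes "0 < r" "power_series r c f"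
  shows "taylor_coeff x f = c x"
proof -
  obtain ps where ps: "distinct ps" "set ps = UNIV"
    "\<And>f. iter_partial (curry x) f = foldr (\<lambda>(i, j) g. (partial i j ^^ x (i, j)) g) ps f"
    by (rule iter_partial_foldr[of x]) blast
  from power_series_at_0[OF assms(1) power_series_foldr_partial[OF ps(1) assms(2)], of x]
  have "iter_partial (curry x) f 0 = (\<Prod>p\<in>UNIV. fact (x p)) * c x"
    by (simp add: ps)
  then show ?thesis
    by (simp add: taylor_coeff_def)
qed

text \<open>
  Differentiating only in the directions \<open>p\<close> with \<open>x p \<noteq> 0\<close> never leaves the slice where the other
  variables vanish. This is used to replace the logarithmic derivatives in \<open>\<Gamma>\<close>, which contain
  reciprocals, by expressions that are visibly power series.
\<close>

lemma taylor_coeff_cong_slice: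
  fixes f g :: "'n::{finite,linorder} sqmat \<Rightarrow> real"
  assumes r: "0 < r"
    and eq: "\<And>R. R \<in> polydisc r \<Longrightarrow> (\<And>p. x p = 0 \<Longrightarrow> coord p R = 0) \<Longrightarrow> f R = g R"
  shows "taylor_coeff x f = taylor_coeff x g"
proof -
  define agree where "agree f g \<longleftrightarrow>
    (\<forall>R\<in>polydisc r. (\<forall>p. x p = 0 \<longrightarrow> coord p R = 0) \<longrightarrow> f R = g R)" for f g :: "'n sqmat \<Rightarrow> real"
  have step: "agree (partial k l f) (partial k l g)" if "agree f g" "x (k, l) \<noteq> 0" for f g k l
    unfolding agree_def
  proof (intro ballI impI)
    fix R :: "'n sqmat" assume R: "R \<in> polydisc r" "\<forall>p. x p = 0 \<longrightarrow> coord p R = 0"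
    have "eventually (\<lambda>t. f (R + t *\<^sub>R axis k (axis l 1)) = g (R + t *\<^sub>R axis k (axis l 1))) (nhds 0)"
      using eventually_polydisc_shift[OF R(1), of k l]
    proof eventually_elim
      case (elim t)
      have "\<forall>p. x p = 0 \<longrightarrow> coord p (R + t *\<^sub>R axis k (axis l 1)) = 0"
        using R(2) that(2) by (auto simp: coord_shift)
      then show ?case using elim that(1) by (auto simp: agree_def)
    qed
    then show "partial k l f R = partial k l g R"
      unfolding partial_def by (rule deriv_cong_ev) simp
  qed
  have steps: "agree ((partial k l ^^ n) f) ((partial k l ^^ n) g)"
    if "agree f g" "n \<noteq> 0 \<Longrightarrow> x (k, l) \<noteq> 0" for f g k l n
    using that by (induction n) (auto intro: step)
  obtain ps where ps: "distinct ps" "set ps = UNIV"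
    "\<And>f. iter_partial (curry x) f = foldr (\<lambda>(i, j) g. (partial i j ^^ x (i, j)) g) ps f"
    by (rule iter_partial_foldr[of x]) blast
  have "agree f g" using eq by (auto simp: agree_def)
  then have folds: "agree (foldr (\<lambda>(i, j) g. (partial i j ^^ x (i, j)) g) qs f)
    (foldr (\<lambda>(i, j) g. (partial i j ^^ x (i, j)) g) qs g)" for qs
    by (induction qs) (auto intro: steps)
  have "iter_partial (curry x) f 0 = iter_partial (curry x) g 0"
    using bspec[OF folds[of ps, unfolded agree_def] zero_in_polydisc[OF r]]
    by (simp add: ps(3) coord_def)
  then show ?thesis
    by (simp add: taylor_coeff_def)
qed

lemma taylor_coeff_coord_mult:
  assumes "0 < r" "polydisc_analytic r f"
  shows "taylor_coeff x (\<lambda>R. coord p R * f R) =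
    (if x p = 0 then 0 else taylor_coeff (x(p := x p - 1)) f)"
proof -
  obtain c where c: "power_series r c f" using assms(2) by (auto simp: polydisc_analytic_def)
  show ?thesis
    unfolding taylor_coeff_eq[OF assms(1) c] taylor_coeff_eq[OF assms(1) power_series_coord_mult[OF c]] ..
qed

lemma taylor_coeff_cmult:
  assumes "0 < r" "polydisc_analytic r f"
  shows "taylor_coeff x (\<lambda>R. a * f R) = a * taylor_coeff x f"
proof -
  obtain c where c: "power_series r c f" using assms(2) by (auto simp: polydisc_analytic_def)
  show ?thesis
    unfolding taylor_coeff_eq[OF assms(1) c] taylor_coeff_eq[OF assms(1) power_series_cmult[OF c]] ..
qed

lemma taylor_coeff_const:
  "taylor_coeff x (\<lambda>R. a) = (if x = (\<lambda>p. 0) then a else 0)"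
  by (rule taylor_coeff_eq[OF zero_less_one power_series_const])

lemma taylor_coeff_sum:
  assumes "0 < r" "finite I" "\<And>i. i \<in> I \<Longrightarrow> polydisc_analytic r (f i)"
  shows "taylor_coeff x (\<lambda>R. \<Sum>i\<in>I. f i R) = (\<Sum>i\<in>I. taylor_coeff x (f i))"
proof -
  have "\<forall>i\<in>I. \<exists>c. power_series r c (f i)" using assms(3) by (auto simp: polydisc_analytic_def)
  then obtain c where c: "\<And>i. i \<in> I \<Longrightarrow> power_series r (c i) (f i)" by metis
  have "power_series r (\<lambda>\<alpha>. \<Sum>i\<in>I. c i \<alpha>) (\<lambda>R. \<Sum>i\<in>I. f i R)"
    by (rule power_series_sum[OF assms(2) c])
  from taylor_coeff_eq[OF assms(1) this] show ?thesis
    by (simp add: taylor_coeff_eq[OF assms(1) c])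
qed

section \<open>The Lagrange determinant\<close>

text \<open>
  Conjugation by the diagonal matrix of the \<open>s p\<close>, proved permutation by permutation so that the
  \<open>s p\<close> may vanish: a permutation permutes the points that it moves.
\<close>

lemma det_scale_row_eq_scale_column:
  fixes a s :: "'m::finite \<Rightarrow> real" and b :: "'m \<Rightarrow> 'm \<Rightarrow> real"
  shows "det (\<chi> p q. (if p = q then a p else 0) - s p * b p q :: real^'m^'m)
       = det (\<chi> p q. (if p = q then a p else 0) - s q * b p q :: real^'m^'m)"
proof -
  have "(\<Prod>p\<in>UNIV. (if p = \<sigma> p then a p else 0) - s p * b p (\<sigma> p))
      = (\<Prod>p\<in>UNIV. (if p = \<sigma> p then a p else 0) - s (\<sigma> p) * b p (\<sigma> p))"
    if \<sigma>: "\<sigma> permutes UNIV" for \<sigma>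
  proof -
    \<comment> \<open>Only a moved point contributes an off-diagonal factor \<open>s p * b p (\<sigma> p)\<close>.\<close>
    let ?F = "{p. \<sigma> p = p}"
    let ?t = "\<lambda>s' p. (if p = \<sigma> p then a p else 0) - s' p * b p (\<sigma> p)"
    have split: "(\<Prod>p\<in>UNIV. ?t s' p) = (\<Prod>p\<in>?F. ?t s' p) * ((\<Prod>p\<in>-?F. s' p) * (\<Prod>p\<in>-?F. - b p (\<sigma> p)))" for s'
    proof -
      have "(\<Prod>p\<in>UNIV. ?t s' p) = (\<Prod>p\<in>?F. ?t s' p) * (\<Prod>p\<in>-?F. ?t s' p)"
        by (subst prod.union_disjoint[symmetric]) auto
      also have "(\<Prod>p\<in>-?F. ?t s' p) = (\<Prod>p\<in>-?F. s' p * - b p (\<sigma> p))"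
        by (intro prod.cong) auto
      finally show ?thesis by (simp only: prod.distrib)
    qed
    have bij: "bij \<sigma>" using \<sigma> by (rule permutes_bij)
    have "\<sigma> ` ?F = ?F" by force
    then have "bij_betw \<sigma> (-?F) (-?F)"
      using bij_image_Compl_eq[OF bij, of ?F] bij_betw_subset[OF bij, of "-?F" "-?F"] by simp
    then have "(\<Prod>p\<in>-?F. s (\<sigma> p)) = (\<Prod>p\<in>-?F. s p)"
      by (rule prod.reindex_bij_betw)
    moreover have "(\<Prod>p\<in>?F. ?t s p) = (\<Prod>p\<in>?F. ?t (\<lambda>p. s (\<sigma> p)) p)"
      by (intro prod.cong) auto
    ultimately show ?thesis
      unfolding split[of s] split[of "\<lambda>p. s (\<sigma> p)"] by simp
  qed
  then show ?thesis
    by (simp add: det_def)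
qed

lemma det_eq_0_if_left_kernel:
  fixes M :: "real^'m^'m"
  assumes "\<And>q. (\<Sum>p\<in>UNIV. y p * M $ p $ q) = 0" "y p0 \<noteq> 0"
  shows "det M = 0"
proof (rule ccontr)
  assume "det M \<noteq> 0"
  then have "invertible (transpose M)"
    by (simp add: invertible_det_nz)
  then have ker: "\<And>v. transpose M *v v = 0 \<Longrightarrow> v = 0"
    using matrix_left_invertible_ker[of "transpose M"] by (auto simp: invertible_def)
  have "transpose M *v (\<chi> p. y p) = 0"
    using assms(1) by (simp add: vec_eq_iff matrix_vector_mult_def transpose_def mult.commute)
  then have "(\<chi> p. y p) = (0 :: real^'m)"
    by (rule ker)
  then show False
    using assms(2) by (simp add: vec_eq_iff)
qed

text \<open>
  For \<open>x p > 0\<close>, row \<open>p\<close> is \<open>\<phi> p ^ x p\<close> times row \<open>p\<close> of \<open>I - \<Gamma>\<close>, because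
  \<open>\<phi> ^ x * (d\<phi> / \<phi>) = d(\<phi> ^ x) / x\<close>. For \<open>x p = 0\<close> division by zero makes it a row of the identity,
  which is the value of that row of \<open>I - \<Gamma>\<close> where \<open>R\<^sub>p = 0\<close>. In this form there are no
  reciprocals.
\<close>

definition lagrange_det ::
  "('n \<times> 'n \<Rightarrow> real^'n^'n \<Rightarrow> real) \<Rightarrow> ('n::finite \<times> 'n \<Rightarrow> nat) \<Rightarrow> real^'n^'n \<Rightarrow> real" where
  "lagrange_det \<phi> x R = det (\<chi> p q. (if p = q then \<phi> p R ^ x p else 0)
     - coord p R * (partial (fst q) (snd q) (\<lambda>S. \<phi> p S ^ x p) R / real (x p)))"

lemma polydisc_analytic_lagrange_det:
  assumes "\<And>p. polydisc_analytic r (\<phi> p)"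
  shows "polydisc_analytic r (lagrange_det \<phi> x)"
proof -
  have entry: "polydisc_analytic r (\<lambda>R. (if p = q then \<phi> p R ^ x p else 0)
     - coord p R * (partial (fst q) (snd q) (\<lambda>S. \<phi> p S ^ x p) R / real (x p)))" for p q
  proof -
    have "polydisc_analytic r (\<lambda>R. if p = q then \<phi> p R ^ x p else 0)"
      by (cases "p = q") (simp_all add: polydisc_analytic_power[OF assms] polydisc_analytic_const)
    moreover have "polydisc_analytic r (\<lambda>R. (- 1 / real (x p)) * (coord p R * partial (fst q) (snd q) (\<lambda>S. \<phi> p S ^ x p) R))"
      by (rule polydisc_analytic_cmult, rule polydisc_analytic_mult, rule polydisc_analytic_coord,
          rule polydisc_analytic_partial, rule polydisc_analytic_power, rule assms)
    ultimately show ?thesis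
      using polydisc_analytic_add by fastforce
  qed
  show ?thesis
    unfolding lagrange_det_def[abs_def] by (rule polydisc_analytic_det, unfold vec_lambda_beta, rule entry)
qed

text \<open>
  The Euler operator acts diagonally on monomials; this is why the variable should stand with the
  column and not with the row of the determinant.
\<close>

lemma power_series_euler:
  fixes q :: "'n::finite \<times> 'n"
  assumes "power_series r c f"
  shows "power_series r (\<lambda>\<alpha>. real (\<alpha> q) * c \<alpha>) (\<lambda>R. coord q R * partial (fst q) (snd q) f R)"
proof -
  have "(\<lambda>\<alpha>. if \<alpha> q = 0 then 0 else real (Suc ((\<alpha>(q := \<alpha> q - 1)) q)) *
          c ((\<alpha>(q := \<alpha> q - 1))(q := Suc ((\<alpha>(q := \<alpha> q - 1)) q)))) = (\<lambda>\<alpha>. real (\<alpha> q) * c \<alpha>)"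
    by (rule ext) (simp add: fun_upd_idem)
  with power_series_coord_mult[OF power_series_partial[OF assms, of "fst q" "snd q"], of q]
  show ?thesis by (simp only: prod.collapse)
qed

text \<open>
  The one step where the determinant matters. Scaling columns instead of rows, entry \<open>(p, q)\<close> has
  the coefficients \<open>c p \<alpha> * (\<delta> p q - \<alpha> q / x p)\<close>, so by multilinearity in the rows the coefficient
  at \<open>x\<close> is a sum, over families \<open>A\<close> of exponents with \<open>(\<Sum>p. A p) = x\<close>, of multiples of the
  determinants of the matrices \<open>\<delta> p q - A p q / x p\<close>. Multiplied from the left by the row vector
  \<open>x\<close>, such a matrix gives \<open>x q - (\<Sum>p. A p q) = 0\<close>, so each of these determinants vanishes.
\<close>

lemma taylor_coeff_lagrange_det:
  fixes \<phi> :: "'n::{finite,linorder} \<times> 'n \<Rightarrow> 'n sqmat \<Rightarrow> real"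
  assumes r: "0 < r" and \<phi>: "\<And>p. polydisc_analytic r (\<phi> p)" and x: "x \<noteq> (\<lambda>p. 0)"
  shows "taylor_coeff x (lagrange_det \<phi> x) = 0"
proof -
  define h where "h p R = \<phi> p R ^ x p" for p R
  have "\<exists>c. power_series r c (h p) \<and> (x p = 0 \<longrightarrow> c = (\<lambda>\<alpha>. if \<alpha> = (\<lambda>p. 0) then 1 else 0))" for p
  proof (cases "x p = 0")
    case True
    then show ?thesis using power_series_const[of r 1] by (auto simp: h_def[abs_def])
  next
    case False
    then show ?thesis using polydisc_analytic_power[OF \<phi>, of p "x p"]
      by (auto simp: h_def[abs_def] polydisc_analytic_def)
  qed
  from choice[OF allI[OF this]] obtain c where c':
    "\<forall>p. power_series r (c p) (h p) \<and> (x p = 0 \<longrightarrow> c p = (\<lambda>\<alpha>. if \<alpha> = (\<lambda>p. 0) then 1 else 0))"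
    ..
  have c: "power_series r (c p) (h p)"
    and c0: "x p = 0 \<Longrightarrow> c p = (\<lambda>\<alpha>. if \<alpha> = (\<lambda>p. 0) then 1 else 0)" for p
    using spec[OF c', of p] by simp_all
  define \<delta> where "\<delta> p q = (if p = q then 1 else 0 :: real)" for p q :: "'n \<times> 'n"
  define m where "m p q \<alpha> = \<delta> p q - real (\<alpha> q) / real (x p)" for p q and \<alpha> :: "'n \<times> 'n \<Rightarrow> nat"
  define e where "e p q R = (if p = q then h p R else 0)
      - coord q R * (partial (fst q) (snd q) (h p) R / real (x p))" for p q R
  have e: "power_series r (\<lambda>\<alpha>. c p \<alpha> * m p q \<alpha>) (e p q)" for p q
  proof -
    have "power_series r (\<lambda>\<alpha>. \<delta> p q * c p \<alpha> + (- 1 / real (x p)) * (real (\<alpha> q) * c p \<alpha>))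
        (\<lambda>R. \<delta> p q * h p R + (- 1 / real (x p)) * (coord q R * partial (fst q) (snd q) (h p) R))"
      by (rule power_series_add[OF power_series_cmult[OF c] power_series_cmult[OF power_series_euler[OF c]]])
    moreover have "(\<lambda>\<alpha>. \<delta> p q * c p \<alpha> + (- 1 / real (x p)) * (real (\<alpha> q) * c p \<alpha>)) = (\<lambda>\<alpha>. c p \<alpha> * m p q \<alpha>)"
      by (rule ext) (simp add: m_def algebra_simps)
    moreover have "(\<lambda>R. \<delta> p q * h p R + (- 1 / real (x p)) * (coord q R * partial (fst q) (snd q) (h p) R)) = e p q"
      by (rule ext) (simp add: e_def \<delta>_def)
    ultimately show ?thesis by simp
  qed
  define fam where "fam \<gamma> = {A :: 'n \<times> 'n \<Rightarrow> 'n \<times> 'n \<Rightarrow> nat. (\<lambda>q. \<Sum>p\<in>UNIV. A p q) = \<gamma>}" for \<gamma>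
  let ?perms = "{\<sigma>. \<sigma> permutes (UNIV :: ('n \<times> 'n) set)}"
  have det_e: "lagrange_det \<phi> x R = (\<Sum>\<sigma>\<in>?perms. of_int (sign \<sigma>) * (\<Prod>p\<in>UNIV. e p (\<sigma> p) R))" for R
  proof -
    have "lagrange_det \<phi> x R = det (\<chi> p q. e p q R)"
      unfolding lagrange_det_def e_def h_def[abs_def] by (rule det_scale_row_eq_scale_column)
    then show ?thesis by (simp add: det_def)
  qed
  have ps: "power_series r (\<lambda>\<gamma>. \<Sum>\<sigma>\<in>?perms. of_int (sign \<sigma>) *
        (\<Sum>A\<in>fam \<gamma>. \<Prod>p\<in>UNIV. c p (A p) * m p (\<sigma> p) (A p)))
      (\<lambda>R. \<Sum>\<sigma>\<in>?perms. of_int (sign \<sigma>) * (\<Prod>p\<in>UNIV. e p (\<sigma> p) R))"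
    unfolding fam_def
    by (rule power_series_sum, simp add: finite_permutations, rule power_series_cmult,
        rule power_series_prod, rule e)
  have "taylor_coeff x (lagrange_det \<phi> x) = (\<Sum>\<sigma>\<in>?perms. of_int (sign \<sigma>) *
        (\<Sum>A\<in>fam x. \<Prod>p\<in>UNIV. c p (A p) * m p (\<sigma> p) (A p)))"
    using taylor_coeff_eq[OF r ps, of x] unfolding det_e[abs_def] by simp
  also have "\<dots> = (\<Sum>A\<in>fam x. (\<Prod>p\<in>UNIV. c p (A p)) * det (\<chi> p q. m p q (A p)))"
    unfolding det_def prod.distrib sum_distrib_left
    by (subst sum.swap) (simp add: mult.left_commute)
  also have "\<dots> = 0"
  proof (intro sum.neutral ballI)
    fix A assume "A \<in> fam x"
    then have A: "(\<Sum>p\<in>UNIV. A p q) = x q" for q by (auto simp: fam_def)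
    \<comment> \<open>A row with \<open>x p = 0\<close> comes from the constant series 1, so it only admits \<open>A p = 0\<close>.\<close>
    show "(\<Prod>p\<in>UNIV. c p (A p)) * det (\<chi> p q. m p q (A p)) = 0"
    proof (cases "\<exists>p. x p = 0 \<and> A p \<noteq> (\<lambda>q. 0)")
      case True
      then have "(\<Prod>p\<in>UNIV. c p (A p)) = 0"
      proof -
        from True obtain p where "x p = 0" "A p \<noteq> (\<lambda>q. 0)" by blast
        then have "c p (A p) = 0" by (simp add: c0)
        then show ?thesis by (metis UNIV_I finite prod_zero)
      qed
      then show ?thesis by simp
    next
      case False
      obtain p0 where "x p0 \<noteq> 0" using x by blast
      moreover have "(\<Sum>p\<in>UNIV. real (x p) * m p q (A p)) = 0" for q
      proof -
        have "real (x p) * m p q (A p) = (if p = q then real (x q) else 0) - real (A p q)" for p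
        proof (cases "x p = 0")
          case True
          then have "A p = (\<lambda>q. 0)" using False by blast
          then show ?thesis using True by (cases "p = q") simp_all
        qed (simp add: m_def \<delta>_def field_simps)
        then have "(\<Sum>p\<in>UNIV. real (x p) * m p q (A p)) = real (x q) - real (\<Sum>p\<in>UNIV. A p q)"
          by (simp add: sum_subtractf)
        then show ?thesis by (simp only: A)
      qed
      ultimately have "det (\<chi> p q. m p q (A p)) = 0"
        by (intro det_eq_0_if_left_kernel[of "\<lambda>p. real (x p)" _ p0]) simp_all
      then show ?thesis by simp
    qed
  qed
  finally show ?thesis .
qed

section \<open>The matrix generating function of the claims\<close>

lemma polydisc_mono: "R \<in> polydisc s \<Longrightarrow> s \<le> r \<Longrightarrow> R \<in> polydisc r"
  unfolding polydisc_def by (auto intro: less_le_trans)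

text \<open>
  With nonnegative coefficients, convergence at nonnegative arguments already bounds the double
  series over summands and exponents absolutely, so the order of summation can be exchanged.
\<close>

lemma power_series_suminf_nonneg:
  fixes f :: "'i \<Rightarrow> real^'n^'n \<Rightarrow> real"
  assumes ps: "\<And>i. power_series r (c i) (f i)" and nonneg: "\<And>i \<alpha>. 0 \<le> c i \<alpha>"
    and r: "0 < r"
    and summable: "\<And>R. R \<in> polydisc r \<Longrightarrow> (\<And>p. 0 \<le> coord p R) \<Longrightarrow> (\<lambda>i. f i R) summable_on UNIV"
  shows "power_series r (\<lambda>\<alpha>. infsum (\<lambda>i. c i \<alpha>) UNIV) (\<lambda>R. infsum (\<lambda>i. f i R) UNIV)"
    and "\<And>R. R \<in> polydisc r \<Longrightarrow> (\<lambda>i. f i R) summable_on UNIV"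
proof -
  have joint: "(\<lambda>(i, \<alpha>). c i \<alpha> * monomial R \<alpha>) summable_on UNIV \<times> UNIV" if R: "R \<in> polydisc r" for R :: "real^'n^'n"
  proof -
    let ?a = "\<chi> i j. \<bar>R $ i $ j\<bar>"
    have a: "?a \<in> polydisc r" by (rule polydisc_abs[OF R])
    have "(\<lambda>(i, \<alpha>). c i \<alpha> * monomial ?a \<alpha>) summable_on UNIV \<times> UNIV"
    proof (rule summable_on_SigmaI)
      show "((\<lambda>y. case (i, y) of (i, \<alpha>) \<Rightarrow> c i \<alpha> * monomial ?a \<alpha>) has_sum f i ?a) UNIV" for i
        using power_seriesD[OF ps a] by simp
      show "(\<lambda>i. f i ?a) summable_on UNIV"
        by (rule summable[OF a]) (simp add: coord_def)
      show "0 \<le> (case (i, \<alpha>) of (i, \<alpha>) \<Rightarrow> c i \<alpha> * monomial ?a \<alpha>)" for i \<alpha>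
        using nonneg monomial_abs[of R \<alpha>] by (simp flip: monomial_abs)
    qed
    then have "(\<lambda>x. norm (case x of (i, \<alpha>) \<Rightarrow> c i \<alpha> * monomial R \<alpha>)) summable_on UNIV \<times> UNIV"
      by (rule iffD1[OF summable_on_cong, rotated]) (auto simp: abs_mult nonneg monomial_abs)
    then show ?thesis
      by (rule abs_summable_summable)
  qed
  have total: "((\<lambda>i. f i R) has_sum infsum (\<lambda>(i, \<alpha>). c i \<alpha> * monomial R \<alpha>) (UNIV \<times> UNIV)) UNIV"
    if R: "R \<in> polydisc r" for R :: "real^'n^'n"
    by (rule has_sum_SigmaD[OF has_sum_infsum[OF joint[OF R]]]) (use power_seriesD[OF ps R] in simp)
  then show "\<And>R. R \<in> polydisc r \<Longrightarrow> (\<lambda>i. f i R) summable_on UNIV"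
    using has_sum_imp_summable by blast
  have swapped: "((\<lambda>(\<alpha>, i). c i \<alpha> * monomial R \<alpha>) has_sum infsum (\<lambda>i. f i R) UNIV) (UNIV \<times> UNIV)"
    if R: "R \<in> polydisc r" for R :: "real^'n^'n"
  proof -
    have "((\<lambda>(i, \<alpha>). c i \<alpha> * monomial R \<alpha>) has_sum infsum (\<lambda>i. f i R) UNIV) (UNIV \<times> UNIV)"
      using has_sum_infsum[OF joint[OF R]] infsumI[OF total[OF R]] by simp
    then show ?thesis
      by (rule iffD1[OF has_sum_reindex_bij_witness[where i = prod.swap and j = prod.swap], rotated -1]) auto
  qed
  have coeff: "(\<lambda>i. c i \<alpha>) summable_on UNIV" for \<alpha>
  proof -
    let ?h = "(\<chi> i j. r / 2)"
    have "(\<lambda>i. c i \<alpha> * monomial ?h \<alpha>) summable_on UNIV"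
      by (rule summable_on_SigmaD1[OF has_sum_imp_summable[OF swapped]]) (use r in \<open>auto simp: polydisc_def\<close>)
    moreover have "monomial ?h \<alpha> > 0"
      unfolding monomial_def by (rule prod_pos) (use r in \<open>simp add: coord_def\<close>)
    ultimately show ?thesis
      by (simp add: summable_on_cmult_left')
  qed
  show "power_series r (\<lambda>\<alpha>. infsum (\<lambda>i. c i \<alpha>) UNIV) (\<lambda>R. infsum (\<lambda>i. f i R) UNIV)"
    unfolding power_series_def
  proof
    fix R :: "real^'n^'n" assume R: "R \<in> polydisc r"
    show "((\<lambda>\<alpha>. infsum (\<lambda>i. c i \<alpha>) UNIV * monomial R \<alpha>) has_sum infsum (\<lambda>i. f i R) UNIV) UNIV"
      by (rule has_sum_SigmaD[OF swapped[OF R]])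
         (use has_sum_cmult_left[OF has_sum_infsum[OF coeff]] in simp)
  qed
qed

lemma mat_pow_0 [simp]: "mat_pow A 0 = mat 1"
  by (simp add: mat_pow_def)

lemma mat_pow_Suc: "mat_pow A (Suc m) = A ** mat_pow A m"
  by (simp add: mat_pow_def)

lemma mat_pow_add: "mat_pow A (m + n) = mat_pow A m ** mat_pow A n"
  by (induction m) (simp_all add: mat_pow_Suc matrix_mul_assoc)

lemma mat_pow_Suc_right: "mat_pow A (Suc m) = mat_pow A m ** A"
  using mat_pow_add[of A m 1] by (simp add: mat_pow_Suc)

lemma mat_mult_entry: "(A ** B) $ i $ j = (\<Sum>k\<in>UNIV. A $ i $ k * B $ k $ j)"
  by (simp add: matrix_matrix_mult_def)

lemma power_series_mat_pow:
  fixes u w :: "'n::finite"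
  obtains c where "\<And>\<alpha>. 0 \<le> c \<alpha>" "power_series r c (\<lambda>R :: real^'n^'n. mat_pow R m $ u $ w)"
proof -
  have "\<exists>c. (\<forall>\<alpha>. 0 \<le> c \<alpha>) \<and> power_series r c (\<lambda>R :: real^'n^'n. mat_pow R m $ u $ w)"
  proof (induction m arbitrary: u)
    case 0
    show ?case
      unfolding mat_pow_0 mat_def vec_lambda_beta
      by (intro exI[of _ "\<lambda>\<alpha>. if \<alpha> = (\<lambda>p. 0) then if u = w then 1 else 0 else 0"]
          conjI power_series_const) simp
  next
    case (Suc m)
    from choice[OF allI[OF Suc]] obtain c where c:
      "\<forall>k. (\<forall>\<alpha>. 0 \<le> c k \<alpha>) \<and> power_series r (c k) (\<lambda>R :: real^'n^'n. mat_pow R m $ k $ w)" ..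
    have "power_series r (\<lambda>\<alpha>. \<Sum>k\<in>UNIV. if \<alpha> (u, k) = 0 then 0 else c k (\<alpha>((u, k) := \<alpha> (u, k) - 1)))
        (\<lambda>R. \<Sum>k\<in>UNIV. coord (u, k) R * mat_pow R m $ k $ w)"
      by (rule power_series_sum[OF finite], rule power_series_coord_mult)
         (use spec[OF c] in blast)
    moreover have "(\<lambda>R. \<Sum>k\<in>UNIV. coord (u, k) R * mat_pow R m $ k $ w) = (\<lambda>R. mat_pow R (Suc m) $ u $ w)"
      by (simp add: mat_pow_Suc mat_mult_entry coord_def)
    ultimately show ?case
      using spec[OF c] by (intro exI conjI) (auto intro!: sum_nonneg)
  qed
  then show ?thesis using that by blast
qed

lemma polydisc_analytic_mat_pow: "polydisc_analytic r (\<lambda>R. mat_pow R m $ u $ w)"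
  by (rule power_series_mat_pow[of r m u w]) (rule polydisc_analyticI)

text \<open>
  On the polydisc of radius \<open>1 / N\<close> all row sums of the absolute values of the entries are at most
  1.
\<close>

lemma mat_pow_abs_le:
  fixes R :: "real^'n^'n"
  assumes "R \<in> polydisc (1 / real CARD('n))"
  shows "\<bar>mat_pow R m $ u $ w\<bar> \<le> 1"
proof (induction m arbitrary: u)
  case 0
  show ?case by (simp add: mat_def)
next
  case (Suc m)
  have "\<bar>mat_pow R (Suc m) $ u $ w\<bar> \<le> (\<Sum>k\<in>UNIV. \<bar>R $ u $ k\<bar> * \<bar>mat_pow R m $ k $ w\<bar>)"
    unfolding mat_pow_Suc mat_mult_entry by (rule order_trans[OF sum_abs]) (simp add: abs_mult)
  also have "\<dots> \<le> (\<Sum>k\<in>(UNIV::'n set). 1 / real CARD('n) * 1)"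
    by (intro sum_mono mult_mono Suc) (use assms in \<open>auto simp: polydisc_def less_imp_le\<close>)
  finally show ?case by simp
qed

lemma matrix_sumsI:
  fixes F :: "nat \<Rightarrow> real^'n^'m"
  assumes "\<And>i j. (\<lambda>m. F m $ i $ j) sums (L $ i $ j)"
  shows "F sums L"
  using assms unfolding sums_def by (intro vec_tendstoI) (simp add: sum_component)

lemma matrix_sums_entry:
  fixes F :: "nat \<Rightarrow> real^'n^'m"
  assumes "F sums L"
  shows "(\<lambda>m. F m $ i $ j) sums (L $ i $ j)"
  using assms unfolding sums_def by (auto dest!: tendsto_vec_nth[where i = i] tendsto_vec_nth[where i = j] simp: sum_component)

locale nonneg_kernel =
  fixes \<Lambda> :: "nat \<Rightarrow> real^'n^'n::finite"
  assumes nonneg: "\<And>m i j. 0 \<le> \<Lambda> m $ i $ j" and summable: "summable \<Lambda>"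
begin

definition radius :: real where "radius = 1 / real CARD('n)"

lemma radius_pos: "0 < radius" by (simp add: radius_def)

lemma summable_entries: "(\<lambda>(m, w). \<Lambda> m $ w $ v) summable_on UNIV"
proof -
  have "(\<lambda>(w, m). \<Lambda> m $ w $ v) summable_on (UNIV \<times> UNIV)"
  proof (rule summable_on_SigmaI[where g = "\<lambda>w. infsum (\<lambda>m. \<Lambda> m $ w $ v) UNIV"])
    fix w
    have "summable (\<lambda>m. \<Lambda> m $ w $ v)"
      using matrix_sums_entry[OF summable_sums[OF summable]] sums_summable by blast
    then have "(\<lambda>m. \<Lambda> m $ w $ v) summable_on UNIV"
      by (subst summable_on_UNIV_nonneg_real_iff) (auto simp: nonneg)
    then show "((\<lambda>m. case (w, m) of (w, m) \<Rightarrow> \<Lambda> m $ w $ v) has_sum infsum (\<lambda>m. \<Lambda> m $ w $ v) UNIV) UNIV"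
      by (simp add: has_sum_infsum)
  qed (auto simp: nonneg)
  then show ?thesis
    using summable_on_reindex_bij_witness[of UNIV prod.swap prod.swap UNIV
        "\<lambda>(m, w). \<Lambda> m $ w $ v" "\<lambda>(w, m). \<Lambda> m $ w $ v"] by auto
qed

definition total :: "'n \<Rightarrow> real" where "total v = infsum (\<lambda>(m, w). \<Lambda> m $ w $ v) UNIV"

lemma summable_terms:
  assumes "R \<in> polydisc radius"
  shows "(\<lambda>(m, w). mat_pow R m $ u $ w * \<Lambda> m $ w $ v) summable_on UNIV"
    and "\<bar>infsum (\<lambda>(m, w). mat_pow R m $ u $ w * \<Lambda> m $ w $ v) UNIV\<bar> \<le> total v"
proof -
  have le: "\<bar>mat_pow R m $ u $ w * \<Lambda> m $ w $ v\<bar> \<le> \<Lambda> m $ w $ v" for m w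
    using mult_right_mono[OF mat_pow_abs_le[of R m u w] nonneg[of m w v]] assms
    by (simp add: abs_mult nonneg radius_def)
  have abs: "(\<lambda>x. norm (case x of (m, w) \<Rightarrow> mat_pow R m $ u $ w * \<Lambda> m $ w $ v)) summable_on UNIV"
    by (rule summable_on_comparison_test[OF summable_entries[of v]]) (use le in auto)
  then show "(\<lambda>(m, w). mat_pow R m $ u $ w * \<Lambda> m $ w $ v) summable_on UNIV"
    by (rule abs_summable_summable)
  have "\<bar>infsum (\<lambda>(m, w). mat_pow R m $ u $ w * \<Lambda> m $ w $ v) UNIV\<bar> \<le>
      infsum (\<lambda>x. norm (case x of (m, w) \<Rightarrow> mat_pow R m $ u $ w * \<Lambda> m $ w $ v)) UNIV"
    using norm_infsum_bound[OF abs] by simp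
  also have "\<dots> \<le> total v"
    unfolding total_def by (rule infsum_mono[OF abs summable_entries]) (use le in auto)
  finally show "\<bar>infsum (\<lambda>(m, w). mat_pow R m $ u $ w * \<Lambda> m $ w $ v) UNIV\<bar> \<le> total v" .
qed

lemma Lambda_hat_sums:
  assumes "R \<in> polydisc radius"
  shows "(\<lambda>m. mat_pow R m ** \<Lambda> m) sums Lambda_hat \<Lambda> R"
    and "Lambda_hat \<Lambda> R $ u $ v = infsum (\<lambda>(m, w). mat_pow R m $ u $ w * \<Lambda> m $ w $ v) UNIV"
proof -
  have entry: "(\<lambda>m. (mat_pow R m ** \<Lambda> m) $ u $ v) sums
      infsum (\<lambda>(m, w). mat_pow R m $ u $ w * \<Lambda> m $ w $ v) UNIV" for u v
  proof (rule has_sum_imp_sums, rule has_sum_SigmaD)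
    show "((\<lambda>(m, w). mat_pow R m $ u $ w * \<Lambda> m $ w $ v) has_sum
        infsum (\<lambda>(m, w). mat_pow R m $ u $ w * \<Lambda> m $ w $ v) UNIV) (UNIV \<times> UNIV)"
      using has_sum_infsum[OF summable_terms(1)[OF assms]] by simp
  qed (auto simp: mat_mult_entry)
  then have "(\<lambda>m. mat_pow R m ** \<Lambda> m) sums
      (\<chi> u v. infsum (\<lambda>(m, w). mat_pow R m $ u $ w * \<Lambda> m $ w $ v) UNIV)"
    by (intro matrix_sumsI) simp
  then show sums: "(\<lambda>m. mat_pow R m ** \<Lambda> m) sums Lambda_hat \<Lambda> R"
    unfolding Lambda_hat_def by (simp add: sums_iff)
  show "Lambda_hat \<Lambda> R $ u $ v = infsum (\<lambda>(m, w). mat_pow R m $ u $ w * \<Lambda> m $ w $ v) UNIV"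
    using sums_unique2[OF matrix_sums_entry[OF sums] entry] .
qed

lemma Lambda_hat_bound:
  assumes "R \<in> polydisc radius"
  shows "\<bar>Lambda_hat \<Lambda> R $ u $ v\<bar> \<le> total v"
  using summable_terms(2)[OF assms] Lambda_hat_sums(2)[OF assms] by simp

lemma polydisc_analytic_Lambda_hat: "polydisc_analytic radius (\<lambda>R. Lambda_hat \<Lambda> R $ u $ v)"
proof -
  have "\<exists>c. (\<forall>\<alpha>. 0 \<le> c \<alpha>) \<and>
      power_series radius c (\<lambda>R :: real^'n^'n. case x of (m, w) \<Rightarrow> mat_pow R m $ u $ w * \<Lambda> m $ w $ v)" for x
  proof -
    obtain m w where x: "x = (m, w)" by (cases x)
    obtain c where c: "\<And>\<alpha>. 0 \<le> c \<alpha>" "power_series radius c (\<lambda>R :: real^'n^'n. mat_pow R m $ u $ w)"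
      by (rule power_series_mat_pow[of radius m u w]) blast
    have "power_series radius (\<lambda>\<alpha>. \<Lambda> m $ w $ v * c \<alpha>) (\<lambda>R :: real^'n^'n. \<Lambda> m $ w $ v * mat_pow R m $ u $ w)"
      by (rule power_series_cmult[OF c(2)])
    then show ?thesis
      by (intro exI[of _ "\<lambda>\<alpha>. \<Lambda> m $ w $ v * c \<alpha>"]) (simp add: x c(1) nonneg mult.commute)
  qed
  from choice[OF allI[OF this]] obtain c where c: "\<forall>x. (\<forall>\<alpha>. 0 \<le> c x \<alpha>) \<and>
      power_series radius (c x) (\<lambda>R :: real^'n^'n. case x of (m, w) \<Rightarrow> mat_pow R m $ u $ w * \<Lambda> m $ w $ v)" ..
  have "power_series radius (\<lambda>\<alpha>. infsum (\<lambda>x. c x \<alpha>) UNIV)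
      (\<lambda>R. infsum (\<lambda>(m, w). mat_pow R m $ u $ w * \<Lambda> m $ w $ v) UNIV)"
    by (rule power_series_suminf_nonneg(1)) (use spec[OF c] radius_pos summable_terms in blast)+
  then have "power_series radius (\<lambda>\<alpha>. infsum (\<lambda>x. c x \<alpha>) UNIV) (\<lambda>R. Lambda_hat \<Lambda> R $ u $ v)"
    by (rule power_series_cong) (rule Lambda_hat_sums(2)[symmetric])
  then show ?thesis by (rule polydisc_analyticI)
qed

lemma nonneg_kernel_shift: "nonneg_kernel (\<lambda>m. \<Lambda> (m + K))"
  using nonneg summable by unfold_locales (auto intro: summable_ignore_initial_segment)

text \<open>
  The terms of degree at least \<open>K\<close> are \<open>R ^ K\<close> times a series of the same kind. With \<open>K = 1\<close> this
  shows that the series stays close to \<open>\<Lambda> 0\<close> near the origin; with larger \<open>K\<close> it isolates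
  the finitely many terms that a Taylor coefficient of bounded order can see.
\<close>

lemma Lambda_hat_split:
  assumes R: "R \<in> polydisc radius"
  shows "Lambda_hat \<Lambda> R = (\<Sum>m<K. mat_pow R m ** \<Lambda> m) + mat_pow R K ** Lambda_hat (\<lambda>m. \<Lambda> (m + K)) R"
proof -
  interpret shifted: nonneg_kernel "\<lambda>m. \<Lambda> (m + K)" by (rule nonneg_kernel_shift)
  have "R \<in> polydisc shifted.radius" using R by (simp add: radius_def shifted.radius_def)
  from shifted.Lambda_hat_sums(1)[OF this]
  have s: "(\<lambda>m. mat_pow R m ** \<Lambda> (m + K)) sums Lambda_hat (\<lambda>m. \<Lambda> (m + K)) R" .
  have "(\<lambda>m. mat_pow R K ** (mat_pow R m ** \<Lambda> (m + K))) sums (mat_pow R K ** Lambda_hat (\<lambda>m. \<Lambda> (m + K)) R)"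
    by (intro matrix_sumsI) (simp add: mat_mult_entry[of "mat_pow R K"], intro sums_sum sums_mult matrix_sums_entry s)
  then have "(\<lambda>m. mat_pow R (m + K) ** \<Lambda> (m + K)) sums (mat_pow R K ** Lambda_hat (\<lambda>m. \<Lambda> (m + K)) R)"
    by (simp add: matrix_mul_assoc mat_pow_add[symmetric] add.commute)
  then have "(\<lambda>m. mat_pow R m ** \<Lambda> m) sums
      (mat_pow R K ** Lambda_hat (\<lambda>m. \<Lambda> (m + K)) R + (\<Sum>m<K. mat_pow R m ** \<Lambda> m))"
    by (rule iffD1[OF sums_iff_shift])
  from sums_unique2[OF Lambda_hat_sums(1)[OF R] this] show ?thesis
    by (simp add: add.commute)
qed

text \<open>
  The logarithm in \<open>\<Gamma>\<close> needs positive entries on a whole neighbourhood of the origin, not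
  just at it.
\<close>

lemma Lambda_hat_pos_near0:
  assumes pos: "\<And>i j. 0 < \<Lambda> 0 $ i $ j"
  obtains s where "0 < s" "s \<le> radius" "\<And>R u v. R \<in> polydisc s \<Longrightarrow> 0 < Lambda_hat \<Lambda> R $ u $ v"
proof -
  interpret shifted: nonneg_kernel "\<lambda>m. \<Lambda> (m + 1)" by (rule nonneg_kernel_shift)
  define B where "B = (\<Sum>v\<in>UNIV. shifted.total v) + 1"
  define a where "a = Min (range (\<lambda>(i, j). \<Lambda> 0 $ i $ j))"
  have total_nonneg: "0 \<le> shifted.total v" for v
    unfolding shifted.total_def by (rule infsum_nonneg) (auto simp: nonneg)
  have "shifted.total v \<le> (\<Sum>v\<in>UNIV. shifted.total v)" for v
    by (rule member_le_sum) (rule UNIV_I, rule total_nonneg, rule finite)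
  moreover have "0 \<le> (\<Sum>v\<in>UNIV. shifted.total v)"
    by (rule sum_nonneg) (rule total_nonneg)
  ultimately have B: "shifted.total v \<le> B" "0 < B" for v
    unfolding B_def by (simp_all only: add_increasing2 zero_le_one add_nonneg_pos zero_less_one)
  have a: "0 < a" "a \<le> \<Lambda> 0 $ i $ j" for i j
    by (auto simp: a_def pos intro!: Min_le image_eqI[of _ _ "(i, j)"])
  \<comment> \<open>The remainder \<open>R ** Lambda_hat\<close> of the shifted kernel has entries at most \<open>N * s * B \<le> a / 2\<close>.\<close>
  define s where "s = min radius (a / (2 * B * real CARD('n)))"
  show ?thesis
  proof
    show "0 < s" using a B by (simp add: s_def radius_pos)
    show s_le: "s \<le> radius" by (simp add: s_def)
    fix R :: "real^'n^'n" and u v assume R: "R \<in> polydisc s"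
    then have R': "R \<in> polydisc radius" using s_le by (rule polydisc_mono)
    have "\<bar>(R ** Lambda_hat (\<lambda>m. \<Lambda> (m + 1)) R) $ u $ v\<bar> \<le> (\<Sum>k\<in>UNIV. \<bar>R $ u $ k\<bar> * \<bar>Lambda_hat (\<lambda>m. \<Lambda> (m + 1)) R $ k $ v\<bar>)"
      unfolding mat_mult_entry by (rule order_trans[OF sum_abs]) (simp add: abs_mult)
    also have "\<dots> \<le> (\<Sum>k\<in>(UNIV::'n set). a / (2 * B * real CARD('n)) * B)"
    proof (intro sum_mono mult_mono)
      fix k
      have "\<bar>R $ u $ k\<bar> < s" using R by (simp add: polydisc_def)
      then show "\<bar>R $ u $ k\<bar> \<le> a / (2 * B * real CARD('n))" by (simp add: s_def)
      have "\<bar>Lambda_hat (\<lambda>m. \<Lambda> (m + 1)) R $ k $ v\<bar> \<le> shifted.total v"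
        by (rule shifted.Lambda_hat_bound) (use R' in \<open>simp add: radius_def shifted.radius_def\<close>)
      then show "\<bar>Lambda_hat (\<lambda>m. \<Lambda> (m + 1)) R $ k $ v\<bar> \<le> B"
        using B(1)[of v] by linarith
    qed (use a B in auto)
    also have "\<dots> = a / 2" using B by simp
    also have "\<dots> < \<Lambda> 0 $ u $ v" using a(1) a(2)[of u v] by linarith
    finally show "0 < Lambda_hat \<Lambda> R $ u $ v"
      unfolding Lambda_hat_split[OF R', of 1] by (simp add: mat_pow_Suc)
  qed
qed

end

section \<open>The recurrence for V(n, a)\<close>

locale positive_kernel = nonneg_kernel \<Lambda> for \<Lambda> :: "nat \<Rightarrow> 'n::{finite,linorder} sqmat" +
  assumes pos: "\<And>i j. 0 < \<Lambda> 0 $ i $ j"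
begin

definition lam :: "'n \<times> 'n \<Rightarrow> 'n sqmat \<Rightarrow> real" where
  "lam p R = Lambda_hat \<Lambda> R $ fst p $ snd p"

lemma polydisc_analytic_lam: "polydisc_analytic radius (lam p)"
  using polydisc_analytic_Lambda_hat[of "fst p" "snd p"] by (simp add: lam_def[abs_def])

lemma partial_power:
  assumes "R \<in> polydisc radius"
  shows "partial k l (\<lambda>S. lam p S ^ n) R = real n * lam p R ^ (n - 1) * partial k l (lam p) R"
  unfolding partial_def[of k l "\<lambda>S. lam p S ^ n"]
  by (rule DERIV_imp_deriv)
     (rule DERIV_cong[OF DERIV_power[OF polydisc_analytic_has_partial[OF polydisc_analytic_lam assms]]], simp)

lemma partial_ln:
  assumes "R \<in> polydisc radius" "0 < lam p R"
  shows "partial k l (\<lambda>S. ln (lam p S)) R = partial k l (lam p) R / lam p R"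
proof -
  have "((\<lambda>t. lam p (R + t *\<^sub>R axis k (axis l 1))) has_field_derivative partial k l (lam p) R) (at 0)"
    by (rule polydisc_analytic_has_partial[OF polydisc_analytic_lam assms(1)])
  from DERIV_ln_divide assms(2) have "(ln has_field_derivative 1 / lam p R) (at (lam p (R + 0 *\<^sub>R axis k (axis l 1))))"
    by simp
  from DERIV_chain2[OF this polydisc_analytic_has_partial[OF polydisc_analytic_lam assms(1)]]
  show ?thesis
    unfolding partial_def[of k l "\<lambda>S. ln (lam p S)"] by (intro DERIV_imp_deriv) simp
qed

lemma lagrange_det_lam:
  assumes R: "R \<in> polydisc radius" and slice: "\<And>p. x p = 0 \<Longrightarrow> coord p R = 0"
  shows "lagrange_det lam x R = det (\<chi> p q. (if p = q then lam p R ^ x p else 0)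
     - coord p R * (lam p R ^ (x p - 1) * partial (fst q) (snd q) (lam p) R))"
proof -
  have "coord p R * (partial k l (\<lambda>S. lam p S ^ x p) R / real (x p))
      = coord p R * (lam p R ^ (x p - 1) * partial k l (lam p) R)" for p k l
    by (cases "x p = 0") (simp_all add: slice partial_power[OF R])
  then show ?thesis
    unfolding lagrange_det_def by simp
qed

text \<open>
  Distributes one factor of the product to each row of the determinant.
\<close>

lemma integrand_on_slice:
  assumes R: "R \<in> polydisc radius" and slice: "\<And>p. x p = 0 \<Longrightarrow> coord p R = 0"
    and lam: "\<And>p. 0 < lam p R"
  shows "(\<Prod>p\<in>UNIV. lam p R ^ x p) * det (mat 1 - Gamma_mat \<Lambda> R) = lagrange_det lam x R"
proof -
  have Gamma: "Gamma_mat \<Lambda> R $ p $ q = coord p R * (partial (fst q) (snd q) (lam p) R / lam p R)" for p q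
  proof -
    have "partial (fst q) (snd q) (\<lambda>S. ln (Lambda_hat \<Lambda> S $ fst p $ snd p)) R
        = partial (fst q) (snd q) (lam p) R / lam p R"
      using partial_ln[OF R lam, of "fst q" "snd q" p] by (simp add: lam_def)
    then show ?thesis
      by (cases p; cases q) (simp add: Gamma_mat_def coord_def)
  qed
  have "(\<Prod>p\<in>UNIV. lam p R ^ x p) * det (mat 1 - Gamma_mat \<Lambda> R)
      = (\<Prod>p\<in>UNIV. lam p R ^ x p) * det (\<chi> p. (mat 1 - Gamma_mat \<Lambda> R) $ p)"
    by (simp only: vec_lambda_eta)
  also have "\<dots> = det (\<chi> p. lam p R ^ x p *s (mat 1 - Gamma_mat \<Lambda> R) $ p)"
    by (rule det_rows_mul[symmetric])
  also have "(\<chi> p. lam p R ^ x p *s (mat 1 - Gamma_mat \<Lambda> R) $ p) =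
    (\<chi> p q. (if p = q then lam p R ^ x p else 0)
     - coord p R * (lam p R ^ (x p - 1) * partial (fst q) (snd q) (lam p) R))"
  proof -
    have entry: "lam p R ^ x p * ((if p = q then 1 else 0) - coord p R * (d / lam p R))
       = (if p = q then lam p R ^ x p else 0) - coord p R * (lam p R ^ (x p - 1) * d)" for p q d
    proof (cases "x p")
      case 0
      then show ?thesis by (cases "p = q") (simp_all add: slice)
    next
      case (Suc n)
      then show ?thesis using lam[of p] by (cases "p = q") (simp_all add: field_simps)
    qed
    then show ?thesis
      by (simp only: vec_eq_iff vec_lambda_beta vector_smult_component vector_minus_component Gamma mat_def
          entry) simp
  qed
  also have "det \<dots> = lagrange_det lam x R"
    by (rule lagrange_det_lam[OF R slice, symmetric])
  finally show ?thesis .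
qed

text \<open>
  Raising \<open>x p\<close> by one multiplies row \<open>p\<close> by \<open>lam p\<close>. If \<open>x p = 0\<close> this is only true where
  \<open>R\<^sub>p = 0\<close>.
\<close>

lemma lagrange_det_Suc_on_slice:
  assumes R: "R \<in> polydisc radius" and slice: "\<And>q. x q = 0 \<Longrightarrow> coord q R = 0"
  shows "lagrange_det lam (x(p := Suc (x p))) R = lam p R * lagrange_det lam x R"
proof -
  let ?a = "\<lambda>x p. \<chi> q. (if p = q then lam p R ^ x p else 0)
     - coord p R * (lam p R ^ (x p - 1) * partial (fst q) (snd q) (lam p) R)"
  let ?x' = "x(p := Suc (x p))"
  let ?c = "\<lambda>i. if i = p then lam p R else 1"
  have slice': "\<And>q. ?x' q = 0 \<Longrightarrow> coord q R = 0"
    using slice by (simp split: if_splits)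
  have row: "?a ?x' i = ?c i *s ?a x i" for i
  proof (cases "i = p")
    case True
    show ?thesis
    proof (cases "x p")
      case 0
      then show ?thesis using True slice[of p] by (simp add: vec_eq_iff)
    next
      case (Suc n)
      then show ?thesis using True by (simp add: vec_eq_iff algebra_simps)
    qed
  qed (simp add: vec_eq_iff)
  have "lagrange_det lam ?x' R = det (\<chi> i. ?a ?x' i)"
    by (rule lagrange_det_lam[OF R slice'])
  also have "\<dots> = det (\<chi> i. ?c i *s ?a x i)"
    by (simp only: row)
  also have "\<dots> = (\<Prod>i\<in>UNIV. ?c i) * det (\<chi> i. ?a x i)"
    by (rule det_rows_mul)
  also have "(\<Prod>i\<in>UNIV. ?c i) = lam p R"
    by simp
  also have "det (\<chi> i. ?a x i) = lagrange_det lam x R"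
    by (rule lagrange_det_lam[OF R slice, symmetric])
  finally show ?thesis .
qed

text \<open>
  The Lagrange-Good expression with an arbitrary function \<open>f\<close> in place of an entry of \<open>R ^ a\<close>.
  Letting \<open>f\<close> vary is what makes \<open>V(n, a)\<close> amenable to recursion.
\<close>

definition lagrange_functional :: "nat \<Rightarrow> ('n sqmat \<Rightarrow> real) \<Rightarrow> real" where
  "lagrange_functional n f = (\<Sum>x\<in>{x. (\<Sum>p\<in>UNIV. x p) = n}. taylor_coeff x (\<lambda>R. f R * lagrange_det lam x R))"

lemma V_mat_eq_lagrange_functional: "V_mat \<Lambda> n a $ u $ v = lagrange_functional n (\<lambda>R. mat_pow R a $ u $ v)"
proof -
  obtain s where s: "0 < s" "s \<le> radius" "\<And>R u v. R \<in> polydisc s \<Longrightarrow> 0 < Lambda_hat \<Lambda> R $ u $ v"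
    using Lambda_hat_pos_near0[OF pos] by blast
  have prod_pairs: "(\<Prod>i\<in>UNIV. \<Prod>j\<in>UNIV. g i j) = (\<Prod>p\<in>UNIV. g (fst p) (snd p))"
    for g :: "'n \<Rightarrow> 'n \<Rightarrow> real"
    by (simp add: prod.cartesian_product case_prod_unfold)
  have sum_pairs: "(\<Sum>i\<in>UNIV. \<Sum>j\<in>UNIV. g i j) = (\<Sum>p\<in>UNIV. g (fst p) (snd p))"
    for g :: "'n \<Rightarrow> 'n \<Rightarrow> nat"
    by (simp add: sum.cartesian_product case_prod_unfold)
  have summand: "1 / (\<Prod>i\<in>UNIV. \<Prod>j\<in>UNIV. fact (curry x i j)) * C_mat \<Lambda> (curry x) a $ u $ v
      = taylor_coeff x (\<lambda>R. mat_pow R a $ u $ v * lagrange_det lam x R)" for x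
  proof -
    have "1 / (\<Prod>i\<in>UNIV. \<Prod>j\<in>UNIV. fact (curry x i j)) * C_mat \<Lambda> (curry x) a $ u $ v
      = taylor_coeff x (\<lambda>R. mat_pow R a $ u $ v * (\<Prod>p\<in>UNIV. lam p R ^ x p) * det (mat 1 - Gamma_mat \<Lambda> R))"
      by (simp add: C_mat_def taylor_coeff_def prod_pairs lam_def)
    also have "\<dots> = taylor_coeff x (\<lambda>R. mat_pow R a $ u $ v * lagrange_det lam x R)"
    proof (rule taylor_coeff_cong_slice[OF s(1)])
      fix R :: "'n sqmat" assume R: "R \<in> polydisc s" and slice: "\<And>p. x p = 0 \<Longrightarrow> coord p R = 0"
      from R s(2) have "R \<in> polydisc radius" by (rule polydisc_mono)
      from integrand_on_slice[OF this slice] s(3)[OF R]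
      show "mat_pow R a $ u $ v * (\<Prod>p\<in>UNIV. lam p R ^ x p) * det (mat 1 - Gamma_mat \<Lambda> R)
          = mat_pow R a $ u $ v * lagrange_det lam x R"
        by (simp add: lam_def mult.assoc)
    qed
    finally show ?thesis .
  qed
  have "V_mat \<Lambda> n a $ u $ v = (\<Sum>x\<in>{x. (\<Sum>i\<in>UNIV. \<Sum>j\<in>UNIV. x i j) = n}.
      1 / (\<Prod>i\<in>UNIV. \<Prod>j\<in>UNIV. fact (x i j)) * C_mat \<Lambda> x a $ u $ v)"
    by (simp add: V_mat_def sum_component)
  also have "\<dots> = (\<Sum>x\<in>{x. (\<Sum>p\<in>UNIV. x p) = n}.
      1 / (\<Prod>i\<in>UNIV. \<Prod>j\<in>UNIV. fact (curry x i j)) * C_mat \<Lambda> (curry x) a $ u $ v)"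
    by (rule sum.reindex_bij_witness[of _ curry case_prod]) 
       (simp_all add: sum_pairs case_prod_unfold curry_def)
  also have "\<dots> = lagrange_functional n (\<lambda>R. mat_pow R a $ u $ v)"
    by (simp only: summand lagrange_functional_def)
  finally show ?thesis .
qed

lemma analytic_lagrange_integrand: "polydisc_analytic radius f \<Longrightarrow> polydisc_analytic radius (\<lambda>R. f R * lagrange_det lam x R)"
  by (rule polydisc_analytic_mult[OF _ polydisc_analytic_lagrange_det[OF polydisc_analytic_lam]])

lemma lagrange_functional_cong: "(\<And>R. R \<in> polydisc radius \<Longrightarrow> f R = g R) \<Longrightarrow> lagrange_functional n f = lagrange_functional n g"
  unfolding lagrange_functional_def by (intro sum.cong refl taylor_coeff_cong_slice[OF radius_pos]) simp

lemma lagrange_functional_sum: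
  assumes "finite I" "\<And>i. i \<in> I \<Longrightarrow> polydisc_analytic radius (f i)"
  shows "lagrange_functional n (\<lambda>R. \<Sum>i\<in>I. f i R) = (\<Sum>i\<in>I. lagrange_functional n (f i))"
proof -
  have "taylor_coeff x (\<lambda>R. (\<Sum>i\<in>I. f i R) * lagrange_det lam x R)
      = (\<Sum>i\<in>I. taylor_coeff x (\<lambda>R. f i R * lagrange_det lam x R))" for x
    unfolding sum_distrib_right by (rule taylor_coeff_sum[OF radius_pos assms(1)]) (rule analytic_lagrange_integrand[OF assms(2)])
  then show ?thesis
    unfolding lagrange_functional_def by (simp add: sum.swap[of _ I])
qed

lemma lagrange_functional_add:
  assumes "polydisc_analytic radius f" "polydisc_analytic radius g"
  shows "lagrange_functional n (\<lambda>R. f R + g R) = lagrange_functional n f + lagrange_functional n g"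
proof -
  have "lagrange_functional n (\<lambda>R. \<Sum>b\<in>UNIV. (if b then f else g) R) = (\<Sum>b\<in>UNIV. lagrange_functional n (if b then f else g))"
    by (rule lagrange_functional_sum) (simp_all add: assms)
  then show ?thesis by (simp add: UNIV_bool add.commute)
qed

lemma lagrange_functional_cmult:
  assumes "polydisc_analytic radius f"
  shows "lagrange_functional n (\<lambda>R. a * f R) = a * lagrange_functional n f"
  unfolding lagrange_functional_def sum_distrib_left mult.assoc
  by (intro sum.cong refl taylor_coeff_cmult[OF radius_pos analytic_lagrange_integrand[OF assms]])

lemma lagrange_functional_0_coord_mult:
  assumes "polydisc_analytic radius f"
  shows "lagrange_functional 0 (\<lambda>R. coord p R * f R) = 0"
  unfolding lagrange_functional_def mult.assoc
  by (intro sum.neutral ballI)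
     (simp add: taylor_coeff_coord_mult[OF radius_pos analytic_lagrange_integrand[OF assms]] del: split_paired_All)

text \<open>
  The factor \<open>R\<^sub>p\<close> turns the coefficient at \<open>x\<close> into the one at \<open>x\<close> with \<open>x p\<close> lowered by one; the
  determinant, still formed with \<open>x\<close>, then has one factor \<open>lam p\<close> too many, and this factor is
  passed on to \<open>f\<close>. Terms with \<open>x p = 0\<close> vanish.
\<close>

lemma lagrange_functional_Suc_coord_mult:
  assumes "polydisc_analytic radius f"
  shows "lagrange_functional (Suc n) (\<lambda>R. coord p R * f R) = lagrange_functional n (\<lambda>R. lam p R * f R)"
proof -
  let ?X = "\<lambda>n. {x :: 'n \<times> 'n \<Rightarrow> nat. (\<Sum>q\<in>UNIV. x q) = n}"
  have fin: "finite (?X n)" for n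
  proof (rule finite_subset)
    show "?X n \<subseteq> PiE UNIV (\<lambda>_. {..n})"
      by (auto simp: PiE_UNIV_domain intro: member_le_sum)
  qed (intro finite_PiE, auto)
  have "lagrange_functional (Suc n) (\<lambda>R. coord p R * f R) = (\<Sum>x\<in>?X (Suc n).
      if x p = 0 then 0 else taylor_coeff (x(p := x p - 1)) (\<lambda>R. f R * lagrange_det lam x R))"
    unfolding lagrange_functional_def mult.assoc
    by (intro sum.cong refl taylor_coeff_coord_mult[OF radius_pos analytic_lagrange_integrand[OF assms]])
  also have "\<dots> = (\<Sum>x\<in>{x\<in>?X (Suc n). x p \<noteq> 0}.
      taylor_coeff (x(p := x p - 1)) (\<lambda>R. f R * lagrange_det lam x R))"
    by (rule sum.mono_neutral_cong_right) (auto simp: fin)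
  also have "\<dots> = (\<Sum>x\<in>?X n. taylor_coeff x (\<lambda>R. f R * lagrange_det lam (x(p := Suc (x p))) R))"
  proof (rule sum.reindex_bij_witness[of _ "\<lambda>x. x(p := Suc (x p))" "\<lambda>x. x(p := x p - 1)"])
    have upd: "(\<Sum>q\<in>UNIV. (x(p := k)) q) = k + (\<Sum>q\<in>UNIV - {p}. x q)" for x :: "'n \<times> 'n \<Rightarrow> nat" and k
      by (subst sum.remove[of _ p]) (auto intro!: sum.cong)
    have tot: "(\<Sum>q\<in>UNIV. x q) = x p + (\<Sum>q\<in>UNIV - {p}. x q)" for x :: "'n \<times> 'n \<Rightarrow> nat"
      by (rule sum.remove) auto
    fix x
    { assume "x \<in> {x\<in>?X (Suc n). x p \<noteq> 0}"
      then show "x(p := x p - 1) \<in> ?X n"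
        using tot[of x] unfolding mem_Collect_eq upd by linarith }
    { assume "x \<in> ?X n"
      then show "x(p := Suc (x p)) \<in> {x\<in>?X (Suc n). x p \<noteq> 0}"
        using tot[of x] unfolding mem_Collect_eq upd by simp }
  qed simp_all
  also have "\<dots> = lagrange_functional n (\<lambda>R. lam p R * f R)"
    unfolding lagrange_functional_def
    by (intro sum.cong refl taylor_coeff_cong_slice[OF radius_pos]) (simp add: lagrange_det_Suc_on_slice)
  finally show ?thesis .
qed

lemma lagrange_functional_1: "lagrange_functional n (\<lambda>R. 1) = (if n = 0 then 1 else 0)"
proof (cases "n = 0")
  case True
  have "{x :: 'n \<times> 'n \<Rightarrow> nat. (\<Sum>p\<in>UNIV. x p) = 0} = {\<lambda>p. 0}"
    by (auto simp: fun_eq_iff)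
  moreover have "lagrange_det lam (\<lambda>p. 0) R = 1" for R
    using det_I[where ?'a = real and ?'n = "'n \<times> 'n"] by (simp add: lagrange_det_def mat_def cong: if_cong)
  ultimately show ?thesis
    using True by (simp add: lagrange_functional_def taylor_coeff_const)
next
  case False
  then have "taylor_coeff x (lagrange_det lam x) = 0" if "(\<Sum>p\<in>UNIV. x p) = n" for x
    using that by (intro taylor_coeff_lagrange_det[OF radius_pos polydisc_analytic_lam]) auto
  then show ?thesis
    using False by (simp add: lagrange_functional_def)
qed

text \<open>
  The entries of \<open>R ^ b\<close> are homogeneous of degree \<open>b\<close>; this discards the tail of \<open>Lambda_hat\<close>.
\<close>

lemma lagrange_functional_mat_pow_high:
  "polydisc_analytic radius f \<Longrightarrow> n < b \<Longrightarrow> lagrange_functional n (\<lambda>R. mat_pow R b $ u $ w * f R) = 0"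
proof (induction n arbitrary: b u f)
  case 0
  then obtain b' where b: "b = Suc b'" by (cases b) auto
  have ana: "polydisc_analytic radius (\<lambda>R. mat_pow R b' $ k $ w * f R)" for k
    by (rule polydisc_analytic_mult[OF polydisc_analytic_mat_pow 0(1)])
  have "lagrange_functional 0 (\<lambda>R. mat_pow R b $ u $ w * f R) =
      lagrange_functional 0 (\<lambda>R. \<Sum>k\<in>UNIV. coord (u, k) R * (mat_pow R b' $ k $ w * f R))"
    by (simp add: b mat_pow_Suc mat_mult_entry coord_def sum_distrib_right mult.assoc)
  also have "\<dots> = 0"
    by (subst lagrange_functional_sum) (simp_all add: lagrange_functional_0_coord_mult[OF ana] polydisc_analytic_mult[OF polydisc_analytic_coord ana])
  finally show ?case .
next
  case (Suc n)
  then obtain b' where b: "b = Suc b'" by (cases b) auto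
  have ana: "polydisc_analytic radius (\<lambda>R. mat_pow R b' $ k $ w * f R)" for k
    by (rule polydisc_analytic_mult[OF polydisc_analytic_mat_pow Suc.prems(1)])
  have "lagrange_functional (Suc n) (\<lambda>R. mat_pow R b $ u $ w * f R) =
      lagrange_functional (Suc n) (\<lambda>R. \<Sum>k\<in>UNIV. coord (u, k) R * (mat_pow R b' $ k $ w * f R))"
    by (simp add: b mat_pow_Suc mat_mult_entry coord_def sum_distrib_right mult.assoc)
  also have "\<dots> = (\<Sum>k\<in>UNIV. lagrange_functional n (\<lambda>R. lam (u, k) R * (mat_pow R b' $ k $ w * f R)))"
    by (subst lagrange_functional_sum) (simp_all add: lagrange_functional_Suc_coord_mult[OF ana] polydisc_analytic_mult[OF polydisc_analytic_coord ana])
  also have "\<dots> = (\<Sum>k\<in>UNIV. lagrange_functional n (\<lambda>R. mat_pow R b' $ k $ w * (lam (u, k) R * f R)))"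
    by (simp only: mult.left_commute)
  also have "\<dots> = 0"
    using Suc.prems b by (intro sum.neutral ballI Suc.IH polydisc_analytic_mult[OF polydisc_analytic_lam]) auto
  finally show ?case .
qed

lemma V_mat_high: "n < a \<Longrightarrow> V_mat \<Lambda> n a = 0"
  using lagrange_functional_mat_pow_high[OF polydisc_analytic_const[of radius 1]] by (simp add: vec_eq_iff V_mat_eq_lagrange_functional)

lemma V_mat_0: "V_mat \<Lambda> n 0 = (if n = 0 then mat 1 else 0)"
proof -
  have "lagrange_functional n (\<lambda>R :: 'n sqmat. mat 1 $ u $ v) = mat 1 $ u $ v * lagrange_functional n (\<lambda>R. 1)" for u v :: 'n
    using lagrange_functional_cmult[OF polydisc_analytic_const[of radius 1], of n "mat 1 $ u $ v"] by simp
  then show ?thesis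
    by (simp add: vec_eq_iff V_mat_eq_lagrange_functional lagrange_functional_1)
qed

text \<open>
  \<open>R ^ (a + 1) = R ^ a R\<close>, and the last factor \<open>R\<close> is traded for \<open>Lambda_hat\<close>, whose expansion turns
  \<open>R ^ a Lambda_hat\<close> into the sum of the \<open>R ^ (a + m) \<Lambda> m\<close>. The terms with \<open>m > n\<close>
  contribute nothing.
\<close>

lemma V_mat_rec: "V_mat \<Lambda> (Suc n) (Suc a) = (\<Sum>m\<le>n. V_mat \<Lambda> n (a + m) ** \<Lambda> m)"
proof -
  interpret shifted: nonneg_kernel "\<lambda>m. \<Lambda> (m + Suc n)" by (rule nonneg_kernel_shift)
  have "V_mat \<Lambda> (Suc n) (Suc a) $ u $ v = (\<Sum>m\<le>n. V_mat \<Lambda> n (a + m) ** \<Lambda> m) $ u $ v" for u v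
  proof -
    let ?rest = "\<lambda>w R. mat_pow R (a + Suc n) $ u $ w * Lambda_hat (\<lambda>m. \<Lambda> (m + Suc n)) R $ w $ v"
    let ?main = "\<lambda>m w R. \<Lambda> m $ w $ v * mat_pow R (a + m) $ u $ w"
    have ana_rest: "polydisc_analytic radius (\<lambda>R. Lambda_hat (\<lambda>m. \<Lambda> (m + Suc n)) R $ w $ v)" for w
      using shifted.polydisc_analytic_Lambda_hat by (simp add: radius_def shifted.radius_def)
    have ana: "polydisc_analytic radius (?rest w)" "polydisc_analytic radius (?main m w)" for m w
      by (rule polydisc_analytic_mult[OF polydisc_analytic_mat_pow ana_rest],
          rule polydisc_analytic_cmult[OF polydisc_analytic_mat_pow])
    have "V_mat \<Lambda> (Suc n) (Suc a) $ u $ v = lagrange_functional (Suc n) (\<lambda>R. \<Sum>k\<in>UNIV. coord (k, v) R * mat_pow R a $ u $ k)"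
      by (simp add: V_mat_eq_lagrange_functional mat_pow_Suc_right mat_mult_entry coord_def mult.commute)
    also have "\<dots> = (\<Sum>k\<in>UNIV. lagrange_functional n (\<lambda>R. lam (k, v) R * mat_pow R a $ u $ k))"
      by (subst lagrange_functional_sum) (simp_all add: lagrange_functional_Suc_coord_mult[OF polydisc_analytic_mat_pow]
            polydisc_analytic_mult[OF polydisc_analytic_coord polydisc_analytic_mat_pow])
    also have "\<dots> = lagrange_functional n (\<lambda>R. \<Sum>k\<in>UNIV. lam (k, v) R * mat_pow R a $ u $ k)"
      by (subst lagrange_functional_sum) (simp_all add: polydisc_analytic_mult[OF polydisc_analytic_lam polydisc_analytic_mat_pow])
    also have "\<dots> = lagrange_functional n (\<lambda>R. (mat_pow R a ** Lambda_hat \<Lambda> R) $ u $ v)"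
      by (simp add: mat_mult_entry lam_def mult.commute)
    also have "\<dots> = lagrange_functional n (\<lambda>R. (\<Sum>x\<in>{..n} \<times> UNIV. ?main (fst x) (snd x) R) + (\<Sum>w\<in>UNIV. ?rest w R))"
    proof (rule lagrange_functional_cong)
      fix R :: "'n sqmat" assume R: "R \<in> polydisc radius"
      have split: "mat_pow R a ** (S + mat_pow R (Suc n) ** Q) = mat_pow R a ** S + mat_pow R (a + Suc n) ** Q"
        for S Q by (simp add: matrix_add_ldistrib matrix_mul_assoc mat_pow_add del: add_Suc_right)
      have "(mat_pow R a ** (\<Sum>m<Suc n. mat_pow R m ** \<Lambda> m)) $ u $ v
          = (\<Sum>k\<in>UNIV. \<Sum>m\<le>n. \<Sum>w\<in>UNIV. mat_pow R a $ u $ k * (mat_pow R m $ k $ w * \<Lambda> m $ w $ v))"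
        by (simp add: mat_mult_entry sum_component sum_distrib_left lessThan_Suc_atMost)
      also have "\<dots> = (\<Sum>m\<le>n. \<Sum>w\<in>UNIV. \<Sum>k\<in>UNIV. mat_pow R a $ u $ k * (mat_pow R m $ k $ w * \<Lambda> m $ w $ v))"
        by (subst sum.swap, rule sum.cong[OF refl], rule sum.swap)
      also have "\<dots> = (\<Sum>m\<le>n. \<Sum>w\<in>UNIV. ?main m w R)"
        by (simp add: mat_pow_add mat_mult_entry sum_distrib_left mult_ac)
      finally have main: "(mat_pow R a ** (\<Sum>m<Suc n. mat_pow R m ** \<Lambda> m)) $ u $ v
          = (\<Sum>m\<le>n. \<Sum>w\<in>UNIV. ?main m w R)" .
      show "(mat_pow R a ** Lambda_hat \<Lambda> R) $ u $ v =
          (\<Sum>x\<in>{..n} \<times> UNIV. ?main (fst x) (snd x) R) + (\<Sum>w\<in>UNIV. ?rest w R)"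
        unfolding Lambda_hat_split[OF R, of "Suc n"] split vector_add_component main
          mat_mult_entry[of "mat_pow R (a + Suc n)"] sum.cartesian_product case_prod_unfold ..
    qed
    also have "\<dots> = lagrange_functional n (\<lambda>R. \<Sum>x\<in>{..n} \<times> UNIV. ?main (fst x) (snd x) R) + lagrange_functional n (\<lambda>R. \<Sum>w\<in>UNIV. ?rest w R)"
      by (rule lagrange_functional_add; rule polydisc_analytic_sum) (simp_all only: ana finite finite_cartesian_product finite_atMost)
    also have "lagrange_functional n (\<lambda>R. \<Sum>w\<in>UNIV. ?rest w R) = 0"
      by (subst lagrange_functional_sum) (use ana(1) lagrange_functional_mat_pow_high[OF ana_rest, of n "a + Suc n" u] in simp_all)
    also have "lagrange_functional n (\<lambda>R. \<Sum>x\<in>{..n} \<times> UNIV. ?main (fst x) (snd x) R)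
        = (\<Sum>x\<in>{..n} \<times> UNIV. \<Lambda> (fst x) $ snd x $ v * V_mat \<Lambda> n (a + fst x) $ u $ snd x)"
      by (subst lagrange_functional_sum) (simp_all add: ana(2) lagrange_functional_cmult[OF polydisc_analytic_mat_pow] V_mat_eq_lagrange_functional)
    also have "\<dots> = (\<Sum>m\<le>n. V_mat \<Lambda> n (a + m) ** \<Lambda> m) $ u $ v"
      by (simp add: sum_component mat_mult_entry sum.cartesian_product case_prod_unfold mult.commute)
    finally show ?thesis by simp
  qed
  then show ?thesis by (simp add: vec_eq_iff)
qed

end

section \<open>Survival probabilities of the risk model\<close>

definition no_ruin :: "(nat \<Rightarrow> 'a \<Rightarrow> nat) \<Rightarrow> nat \<Rightarrow> 'a \<Rightarrow> bool" where
  "no_ruin C n \<omega> \<longleftrightarrow> (\<forall>k\<in>{1..n}. 0 < surplus C k \<omega>)"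

lemma no_ruin_0 [simp]: "no_ruin C 0 \<omega>"
  by (simp add: no_ruin_def)

lemma no_ruin_Suc: "no_ruin C (Suc n) \<omega> \<longleftrightarrow> no_ruin C n \<omega> \<and> 0 < surplus C (Suc n) \<omega>"
  by (auto simp: no_ruin_def le_Suc_eq)

lemma surplus_Suc: "surplus C (Suc n) \<omega> = surplus C n \<omega> + 1 - int (C (Suc n) \<omega>)"
  by (simp add: surplus_def)

lemma surplus_le: "surplus C n \<omega> \<le> int n"
  by (simp add: surplus_def sum_nonneg)

lemma ruin_time_eq_Suc_iff:
  "ruin_time C \<omega> = enat (Suc n) \<longleftrightarrow> no_ruin C n \<omega> \<and> surplus C (Suc n) \<omega> \<le> 0"
proof -
  define S where "S = {n. 0 < n \<and> surplus C n \<omega> \<le> 0}"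
  have ruin: "ruin_time C \<omega> = Inf (enat ` S)"
    by (simp add: ruin_time_def S_def)
  show ?thesis
  proof
    assume eq: "ruin_time C \<omega> = enat (Suc n)"
    then have "S \<noteq> {}"
      by (auto simp: ruin top_enat_def)
    then have "Inf (enat ` S) \<in> enat ` S"
      unfolding Inf_enat_def by (auto intro: LeastI)
    then have "surplus C (Suc n) \<omega> \<le> 0"
      using eq by (auto simp: ruin S_def)
    moreover have "0 < surplus C k \<omega>" if "k \<in> {1..n}" for k
    proof (rule ccontr)
      assume "\<not> 0 < surplus C k \<omega>"
      then have "k \<in> S" using that by (auto simp: S_def)
      then have "ruin_time C \<omega> \<le> enat k"
        unfolding ruin by (rule INF_lower)
      then show False using eq that by simp
    qed
    ultimately show "no_ruin C n \<omega> \<and> surplus C (Suc n) \<omega> \<le> 0"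
      by (simp add: no_ruin_def)
  next
    assume r: "no_ruin C n \<omega> \<and> surplus C (Suc n) \<omega> \<le> 0"
    show "ruin_time C \<omega> = enat (Suc n)"
      unfolding ruin
    proof (rule antisym)
      show "Inf (enat ` S) \<le> enat (Suc n)"
        by (rule INF_lower) (use r in \<open>simp add: S_def\<close>)
      show "enat (Suc n) \<le> Inf (enat ` S)"
      proof (rule INF_greatest)
        fix k assume k: "k \<in> S"
        show "enat (Suc n) \<le> enat k"
        proof (rule ccontr)
          assume "\<not> enat (Suc n) \<le> enat k"
          then have "k \<in> {1..n}" using k by (auto simp: S_def)
          then show False using r k by (auto simp: no_ruin_def S_def dest: bspec)
        qed
      qed
    qed
  qed
qed

context map_risk_model
begin

text \<open>
  Histories are pairs of lists because these form a countable type, so that every event which is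
  determined by the past is a countable disjoint union of atoms.
\<close>

definition past :: "nat \<Rightarrow> 'a \<Rightarrow> 'n list \<times> nat list" where
  "past n \<omega> = (map (\<lambda>l. J l \<omega>) [0..<Suc n], map (\<lambda>l. C l \<omega>) [1..<Suc n])"

lemma past_eq_iff:
  "past n \<omega> = (js, cs) \<longleftrightarrow> length js = Suc n \<and> length cs = n \<and>
     (\<forall>l<Suc n. J l \<omega> = js ! l) \<and> (\<forall>l\<in>{1..<Suc n}. C l \<omega> = cs ! (l - 1))"
proof -
  have "(\<forall>i<n. C (Suc i) \<omega> = cs ! i) \<longleftrightarrow> (\<forall>l\<in>{1..<Suc n}. C l \<omega> = cs ! (l - 1))"
  proof safe
    fix l assume "\<forall>i<n. C (Suc i) \<omega> = cs ! i" "l \<in> {1..<Suc n}"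
    then show "C l \<omega> = cs ! (l - 1)" by (cases l) auto
  qed force
  then have "map (\<lambda>l. C l \<omega>) [1..<Suc n] = cs \<longleftrightarrow> length cs = n \<and> (\<forall>l\<in>{1..<Suc n}. C l \<omega> = cs ! (l - 1))"
    unfolding list_eq_iff_nth_eq by (simp del: upt_Suc cong: conj_cong) metis
  moreover have "map (\<lambda>l. J l \<omega>) [0..<Suc n] = js \<longleftrightarrow> length js = Suc n \<and> (\<forall>l<Suc n. J l \<omega> = js ! l)"
    unfolding list_eq_iff_nth_eq by (simp del: upt_Suc cong: conj_cong) metis
  ultimately show ?thesis
    unfolding past_def prod.inject by blast
qed

lemma past_cong:
  assumes "past n \<omega> = past n \<omega>'"
  shows "l \<le> n \<Longrightarrow> J l \<omega> = J l \<omega>'" and "1 \<le> l \<Longrightarrow> l \<le> n \<Longrightarrow> C l \<omega> = C l \<omega>'"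
  using past_eq_iff[of n \<omega> "fst (past n \<omega>)" "snd (past n \<omega>)"]
    past_eq_iff[of n \<omega>' "fst (past n \<omega>)" "snd (past n \<omega>)"] assms by auto

lemma surplus_past: "past n \<omega> = past n \<omega>' \<Longrightarrow> k \<le> n \<Longrightarrow> surplus C k \<omega> = surplus C k \<omega>'"
  unfolding surplus_def by (auto intro!: sum.cong dest: past_cong(2))

lemma no_ruin_past: "past n \<omega> = past n \<omega>' \<Longrightarrow> no_ruin C n \<omega> = no_ruin C n \<omega>'"
  unfolding no_ruin_def using surplus_past[of n \<omega> \<omega>'] by auto

lemma event_conj:
  assumes "{\<omega>\<in>space M. Q \<omega>} \<in> events" "{\<omega>\<in>space M. Q' \<omega>} \<in> events"
  shows "{\<omega>\<in>space M. Q \<omega> \<and> Q' \<omega>} \<in> events"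
  by (rule sets.sets_Collect_conj[OF assms(2,1)])

lemma J_event: "{\<omega>\<in>space M. J n \<omega> = j} \<in> events"
  using measurable_sets[OF J_measurable, of "{j}" n] by (simp add: vimage_def Int_def conj_commute)

lemma C_event: "1 \<le> k \<Longrightarrow> {\<omega>\<in>space M. C k \<omega> = c} \<in> events"
  using measurable_sets[OF C_measurable, of k "{c}"] by (simp add: vimage_def Int_def conj_commute)

lemma past_event: "{\<omega>\<in>space M. past n \<omega> = h} \<in> events"
proof -
  obtain js cs where h: "h = (js, cs)" by (cases h)
  let ?B = "{\<omega>\<in>space M. (\<forall>l\<in>{..<Suc n}. J l \<omega> = js ! l) \<and> (\<forall>l\<in>{1..<Suc n}. C l \<omega> = cs ! (l - 1))}"
  have "?B \<in> events"
    by (intro event_conj sets.sets_Collect_finite_All J_event C_event) simp_all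
  moreover have "{\<omega>\<in>space M. past n \<omega> = h} = (if length js = Suc n \<and> length cs = n then ?B else {})"
    unfolding h past_eq_iff by auto
  ultimately show ?thesis
    by simp
qed

lemma past_determined_event:
  assumes "\<And>\<omega> \<omega>'. past n \<omega> = past n \<omega>' \<Longrightarrow> Q \<omega> = Q \<omega>'"
  shows "{\<omega>\<in>space M. Q \<omega>} \<in> events"
proof -
  define H where "H = past n ` {\<omega>. Q \<omega>}"
  have H: "Q \<omega> \<longleftrightarrow> past n \<omega> \<in> H" for \<omega>
  proof
    assume "past n \<omega> \<in> H"
    then obtain \<omega>' where "past n \<omega> = past n \<omega>'" "Q \<omega>'" unfolding H_def by (rule imageE) simp
    then show "Q \<omega>" using assms[of \<omega> \<omega>'] by simp
  qed (simp add: H_def)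
  have "{\<omega>\<in>space M. Q \<omega>} = (\<Union>h\<in>H. {\<omega>\<in>space M. past n \<omega> = h})"
    unfolding H by auto
  also have "\<dots> \<in> events"
    by (intro sets.countable_UN') (simp_all add: past_event image_subset_iff)
  finally show ?thesis .
qed

text \<open>
  If the current state has probability zero, the kernel is not tied to the process, but then both
  sides vanish.
\<close>

lemma prob_step_atom:
  "prob {\<omega>\<in>space M. past n \<omega> = h \<and> C (Suc n) \<omega> = m \<and> J (Suc n) \<omega> = j}
   = prob {\<omega>\<in>space M. past n \<omega> = h} * \<Lambda> m $ (fst h ! n) $ j"
proof -
  obtain js cs where h: "h = (js, cs)" by (cases h)
  show ?thesis
  proof (cases "length js = Suc n \<and> length cs = n")
    case False
    then have "past n \<omega> \<noteq> h" for \<omega> unfolding h past_eq_iff by blast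
    then show ?thesis by simp
  next
    case True
    define i where "i = js ! n"
    define B where "B \<omega> \<longleftrightarrow> (\<forall>l<Suc n. J l \<omega> = js ! l) \<and> (\<forall>l\<in>{1..<Suc n}. C l \<omega> = cs ! (l - 1))" for \<omega>
    have past: "past n \<omega> = h \<longleftrightarrow> B \<omega>" for \<omega>
      unfolding h past_eq_iff B_def using True by blast
    have Bi: "B \<omega> \<and> J n \<omega> = i \<longleftrightarrow> B \<omega>" for \<omega>
      by (auto simp: B_def i_def)
    let ?p = "prob {\<omega>\<in>space M. J n \<omega> = i}"
    show ?thesis
    proof (cases "?p = 0")
      case True
      have "prob {\<omega>\<in>space M. B \<omega> \<and> Q \<omega>} = 0" for Q
      proof -
        have "prob {\<omega>\<in>space M. B \<omega> \<and> Q \<omega>} \<le> ?p"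
          by (rule finite_measure_mono) (use Bi in \<open>auto simp: J_event\<close>)
        then show ?thesis using True measure_nonneg[of M "{\<omega>\<in>space M. B \<omega> \<and> Q \<omega>}"] by linarith
      qed
      from this[of "\<lambda>\<omega>. C (Suc n) \<omega> = m \<and> J (Suc n) \<omega> = j"] this[of "\<lambda>_. True"]
      show ?thesis unfolding past by simp
    next
      case False
      then have p: "?p > 0" by (simp add: zero_less_measure_iff)
      have K: "\<P>(\<omega> in M. C (Suc n) \<omega> = m \<and> J (Suc n) \<omega> = j \<bar> J n \<omega> = i) = \<Lambda> m $ i $ j"
        using kernel[of "Suc n" i m j] p by simp
      have "\<P>(\<omega> in M. (C (Suc n) \<omega> = m \<and> J (Suc n) \<omega> = j) \<and> B \<omega> \<bar> J n \<omega> = i)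
          = \<Lambda> m $ i $ j * \<P>(\<omega> in M. B \<omega> \<bar> J n \<omega> = i)"
        using conditional_independence[of "Suc n" m j "\<lambda>l. js ! l" "\<lambda>l. cs ! (l - 1)" i] K
        by (simp add: B_def)
      moreover have "{\<omega>\<in>space M. ((C (Suc n) \<omega> = m \<and> J (Suc n) \<omega> = j) \<and> B \<omega>) \<and> J n \<omega> = i}
          = {\<omega>\<in>space M. B \<omega> \<and> C (Suc n) \<omega> = m \<and> J (Suc n) \<omega> = j}"
        using Bi by auto
      moreover have "{\<omega>\<in>space M. B \<omega> \<and> J n \<omega> = i} = {\<omega>\<in>space M. B \<omega>}"
        using Bi by auto
      ultimately have "prob {\<omega>\<in>space M. B \<omega> \<and> C (Suc n) \<omega> = m \<and> J (Suc n) \<omega> = j} / ?p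
          = \<Lambda> m $ i $ j * (prob {\<omega>\<in>space M. B \<omega>} / ?p)"
        by (simp only: cond_prob_def)
      then show ?thesis
        using p unfolding past by (simp add: i_def h)
    qed
  qed
qed

text \<open>
  The Markov additive property for an arbitrary event of the past that fixes the current state.
\<close>

lemma prob_step:
  assumes Q: "\<And>\<omega> \<omega>'. past n \<omega> = past n \<omega>' \<Longrightarrow> Q \<omega> = Q \<omega>'" and i: "\<And>\<omega>. Q \<omega> \<Longrightarrow> J n \<omega> = i"
  shows "prob {\<omega>\<in>space M. Q \<omega> \<and> C (Suc n) \<omega> = m \<and> J (Suc n) \<omega> = j} = prob {\<omega>\<in>space M. Q \<omega>} * \<Lambda> m $ i $ j"
proof -
  let ?A = "\<lambda>\<omega>. C (Suc n) \<omega> = m \<and> J (Suc n) \<omega> = j"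
  define H where "H = past n ` {\<omega>. Q \<omega>}"
  have H: "Q \<omega> \<longleftrightarrow> past n \<omega> \<in> H" for \<omega>
  proof
    assume "past n \<omega> \<in> H"
    then obtain \<omega>' where "past n \<omega> = past n \<omega>'" "Q \<omega>'" unfolding H_def by (rule imageE) simp
    then show "Q \<omega>" using Q[of \<omega> \<omega>'] by simp
  qed (simp add: H_def)
  have A: "{\<omega>\<in>space M. ?A \<omega>} \<in> events"
    by (intro event_conj C_event J_event) simp
  have pA: "{\<omega>\<in>space M. past n \<omega> = h \<and> ?A \<omega>} \<in> events" for h
    by (rule event_conj[OF past_event A])
  have last: "fst h ! n = i" if "h \<in> H" for h
  proof -
    from that obtain \<omega> where "Q \<omega>" "h = past n \<omega>" by (auto simp: H_def)
    then show ?thesis using i[of \<omega>] past_eq_iff[of n \<omega> "fst h" "snd h"] by auto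
  qed
  have "emeasure M {\<omega>\<in>space M. Q \<omega> \<and> ?A \<omega>} = emeasure M (\<Union>h\<in>H. {\<omega>\<in>space M. past n \<omega> = h \<and> ?A \<omega>})"
    by (rule arg_cong[where f = "emeasure M"]) (auto simp: H)
  also have "\<dots> = (\<integral>\<^sup>+h. emeasure M {\<omega>\<in>space M. past n \<omega> = h \<and> ?A \<omega>} \<partial>count_space H)"
    by (rule emeasure_UN_countable) (auto simp: pA disjoint_family_on_def)
  also have "\<dots> = (\<integral>\<^sup>+h. ennreal (\<Lambda> m $ i $ j) * emeasure M {\<omega>\<in>space M. past n \<omega> = h} \<partial>count_space H)"
    by (rule nn_integral_cong)
       (simp add: emeasure_eq_measure prob_step_atom last ennreal_mult' \<Lambda>_nonneg mult.commute)
  also have "\<dots> = ennreal (\<Lambda> m $ i $ j) * (\<integral>\<^sup>+h. emeasure M {\<omega>\<in>space M. past n \<omega> = h} \<partial>count_space H)"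
    by (rule nn_integral_cmult) simp
  also have "(\<integral>\<^sup>+h. emeasure M {\<omega>\<in>space M. past n \<omega> = h} \<partial>count_space H)
      = emeasure M (\<Union>h\<in>H. {\<omega>\<in>space M. past n \<omega> = h})"
    by (rule emeasure_UN_countable[symmetric]) (auto simp: past_event disjoint_family_on_def)
  also have "(\<Union>h\<in>H. {\<omega>\<in>space M. past n \<omega> = h}) = {\<omega>\<in>space M. Q \<omega>}"
    by (auto simp: H)
  finally have "ennreal (prob {\<omega>\<in>space M. Q \<omega> \<and> ?A \<omega>}) = ennreal (\<Lambda> m $ i $ j * prob {\<omega>\<in>space M. Q \<omega>})"
    by (simp add: emeasure_eq_measure ennreal_mult' \<Lambda>_nonneg)
  then show ?thesis
    by (simp add: \<Lambda>_nonneg mult.commute)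
qed

lemma prob_step_J:
  assumes Q: "\<And>\<omega> \<omega>'. past n \<omega> = past n \<omega>' \<Longrightarrow> Q \<omega> = Q \<omega>'" and i: "\<And>\<omega>. Q \<omega> \<Longrightarrow> J n \<omega> = i"
  shows "prob {\<omega>\<in>space M. Q \<omega> \<and> J (Suc n) \<omega> = j} = prob {\<omega>\<in>space M. Q \<omega>} * P $ i $ j"
proof -
  let ?X = "\<lambda>m. {\<omega>\<in>space M. Q \<omega> \<and> C (Suc n) \<omega> = m \<and> J (Suc n) \<omega> = j}"
  have Q_event: "{\<omega>\<in>space M. Q \<omega>} \<in> events"
    by (rule past_determined_event) (rule Q)
  have "(\<lambda>m. prob (?X m)) sums prob (\<Union>m. ?X m)"
  proof (rule finite_measure_UNION)
    show "range ?X \<subseteq> events"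
      by (intro image_subsetI event_conj Q_event C_event J_event) simp
  qed (auto simp: disjoint_family_on_def)
  also have "(\<Union>m. ?X m) = {\<omega>\<in>space M. Q \<omega> \<and> J (Suc n) \<omega> = j}" by auto
  finally have "(\<lambda>m. prob {\<omega>\<in>space M. Q \<omega>} * \<Lambda> m $ i $ j) sums prob {\<omega>\<in>space M. Q \<omega> \<and> J (Suc n) \<omega> = j}"
    by (simp only: prob_step[OF Q i])
  moreover have "(\<lambda>m. prob {\<omega>\<in>space M. Q \<omega>} * \<Lambda> m $ i $ j) sums (prob {\<omega>\<in>space M. Q \<omega>} * P $ i $ j)"
    by (intro sums_mult matrix_sums_entry \<Lambda>_sums)
  ultimately show ?thesis by (rule sums_unique2)
qed

text \<open>
  Joint with the initial state rather than conditional on it, so that the recurrence does not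
  involve the initial distribution.
\<close>

definition no_ruin_prob :: "nat \<Rightarrow> nat \<Rightarrow> 'n \<Rightarrow> 'n \<Rightarrow> real" where
  "no_ruin_prob n a i j = prob {\<omega>\<in>space M. (no_ruin C n \<omega> \<and> surplus C n \<omega> = int a) \<and> J n \<omega> = j \<and> J 0 \<omega> = i}"

lemma no_ruin_determined_by_past:
  assumes "past n \<omega> = past n \<omega>'"
  shows "((no_ruin C n \<omega> \<and> surplus C n \<omega> = int a) \<and> J n \<omega> = j \<and> J 0 \<omega> = i) =
     ((no_ruin C n \<omega>' \<and> surplus C n \<omega>' = int a) \<and> J n \<omega>' = j \<and> J 0 \<omega>' = i)"
    and "(no_ruin C n \<omega> \<and> J n \<omega> = j \<and> J 0 \<omega> = i) = (no_ruin C n \<omega>' \<and> J n \<omega>' = j \<and> J 0 \<omega>' = i)"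
  using no_ruin_past[OF assms] surplus_past[OF assms, of n] past_cong(1)[OF assms, of n] past_cong(1)[OF assms, of 0]
  by auto

lemma no_ruin_prob_0:
  "no_ruin_prob 0 a i j = (if a = 0 \<and> i = j then prob {\<omega>\<in>space M. J 0 \<omega> = i} else 0)"
proof -
  have "{\<omega>\<in>space M. (no_ruin C 0 \<omega> \<and> surplus C 0 \<omega> = int a) \<and> J 0 \<omega> = j \<and> J 0 \<omega> = i} =
      (if a = 0 \<and> i = j then {\<omega>\<in>space M. J 0 \<omega> = i} else {})"
    by (auto simp: surplus_def)
  then show ?thesis by (simp add: no_ruin_prob_def)
qed

lemma no_ruin_prob_at_0: "no_ruin_prob (Suc n) 0 i j = 0"
proof -
  have "{\<omega>\<in>space M. (no_ruin C (Suc n) \<omega> \<and> surplus C (Suc n) \<omega> = int 0) \<and> J (Suc n) \<omega> = j \<and> J 0 \<omega> = i} = {}"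
    by (auto simp: no_ruin_Suc)
  then show ?thesis unfolding no_ruin_prob_def by (simp only: measure_empty)
qed

text \<open>
  Decomposes by the last claim \<open>m\<close> and the state \<open>k\<close> before it; since the surplus at time \<open>n\<close> is at
  most \<open>n\<close>, only claims up to \<open>n\<close> can lead to a positive surplus. For \<open>a = m = 0\<close> and \<open>n > 0\<close> the
  summand is zero, because the surplus would have to be both zero and positive at time \<open>n\<close>.
\<close>

lemma no_ruin_prob_rec:
  "no_ruin_prob (Suc n) (Suc a) i j = (\<Sum>m\<le>n. \<Sum>k\<in>UNIV. no_ruin_prob n (a + m) i k * \<Lambda> m $ k $ j)"
proof -
  let ?Q = "\<lambda>m k \<omega>. (no_ruin C n \<omega> \<and> surplus C n \<omega> = int (a + m)) \<and> J n \<omega> = k \<and> J 0 \<omega> = i"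
  let ?X = "\<lambda>x. {\<omega>\<in>space M. ?Q (fst x) (snd x) \<omega> \<and> C (Suc n) \<omega> = fst x \<and> J (Suc n) \<omega> = j}"
  have eq: "{\<omega>\<in>space M. (no_ruin C (Suc n) \<omega> \<and> surplus C (Suc n) \<omega> = int (Suc a)) \<and> J (Suc n) \<omega> = j \<and> J 0 \<omega> = i}
      = (\<Union>x\<in>{..n} \<times> UNIV. ?X x)" (is "?L = ?R")
  proof (intro equalityI subsetI)
    fix \<omega> assume w: "\<omega> \<in> ?L"
    then have "surplus C n \<omega> = int (a + C (Suc n) \<omega>)"
      by (simp add: surplus_Suc)
    moreover from this have "C (Suc n) \<omega> \<le> n" using surplus_le[of C n \<omega>] by simp
    ultimately have "\<omega> \<in> ?X (C (Suc n) \<omega>, J n \<omega>)" "(C (Suc n) \<omega>, J n \<omega>) \<in> {..n} \<times> UNIV"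
      using w by (simp_all add: no_ruin_Suc)
    then show "\<omega> \<in> ?R" by (rule UN_I[rotated])
  next
    fix \<omega> assume "\<omega> \<in> ?R"
    then obtain x where "\<omega> \<in> ?X x" by (rule UN_E)
    then show "\<omega> \<in> ?L" by (simp add: no_ruin_Suc surplus_Suc)
  qed
  have Q_event: "{\<omega>\<in>space M. ?Q m k \<omega>} \<in> events" for m k
    by (rule past_determined_event) (rule no_ruin_determined_by_past(1))
  have "no_ruin_prob (Suc n) (Suc a) i j = (\<Sum>x\<in>{..n} \<times> UNIV. prob (?X x))"
    unfolding no_ruin_prob_def eq
  proof (rule finite_measure_finite_Union)
    show "?X ` ({..n} \<times> UNIV) \<subseteq> events"
      by (rule image_subsetI, rule event_conj[OF Q_event event_conj[OF C_event J_event]]) simp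
  qed (auto simp: disjoint_family_on_def)
  also have "\<dots> = (\<Sum>x\<in>{..n} \<times> UNIV. no_ruin_prob n (a + fst x) i (snd x) * \<Lambda> (fst x) $ snd x $ j)"
    unfolding no_ruin_prob_def by (intro sum.cong refl prob_step) (rule no_ruin_determined_by_past(1), assumption, simp)
  finally show ?thesis
    by (simp add: sum.cartesian_product case_prod_unfold)
qed

lemma prob_no_ruin:
  assumes "0 < n"
  shows "prob {\<omega>\<in>space M. no_ruin C n \<omega> \<and> J n \<omega> = j \<and> J 0 \<omega> = i} = (\<Sum>y=1..n. no_ruin_prob n y i j)"
proof -
  let ?X = "\<lambda>y. {\<omega>\<in>space M. (no_ruin C n \<omega> \<and> surplus C n \<omega> = int y) \<and> J n \<omega> = j \<and> J 0 \<omega> = i}"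
  have "{\<omega>\<in>space M. no_ruin C n \<omega> \<and> J n \<omega> = j \<and> J 0 \<omega> = i} = (\<Union>y\<in>{1..n}. ?X y)" (is "?L = ?R")
  proof (intro equalityI subsetI)
    fix \<omega> assume w: "\<omega> \<in> ?L"
    then have "0 < surplus C n \<omega>" using assms by (auto simp: no_ruin_def)
    then have "\<omega> \<in> ?X (nat (surplus C n \<omega>))" "nat (surplus C n \<omega>) \<in> {1..n}"
      using w surplus_le[of C n \<omega>] by auto
    then show "\<omega> \<in> ?R" by (rule UN_I[rotated])
  qed auto
  moreover have "prob (\<Union>y\<in>{1..n}. ?X y) = (\<Sum>y=1..n. prob (?X y))"
  proof (rule finite_measure_finite_Union)
    show "?X ` {1..n} \<subseteq> events"
      by (rule image_subsetI, rule past_determined_event) (rule no_ruin_determined_by_past(1))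
  qed (auto simp: disjoint_family_on_def)
  ultimately show ?thesis by (simp only: no_ruin_prob_def)
qed

lemma prob_no_ruin_step:
  "prob {\<omega>\<in>space M. no_ruin C n \<omega> \<and> J (Suc n) \<omega> = j \<and> J 0 \<omega> = i}
   = (\<Sum>k\<in>UNIV. prob {\<omega>\<in>space M. no_ruin C n \<omega> \<and> J n \<omega> = k \<and> J 0 \<omega> = i} * P $ k $ j)"
proof -
  let ?X = "\<lambda>k. {\<omega>\<in>space M. (no_ruin C n \<omega> \<and> J n \<omega> = k \<and> J 0 \<omega> = i) \<and> J (Suc n) \<omega> = j}"
  have "{\<omega>\<in>space M. no_ruin C n \<omega> \<and> J (Suc n) \<omega> = j \<and> J 0 \<omega> = i} = (\<Union>k. ?X k)"
    by auto
  also have "prob \<dots> = (\<Sum>k\<in>UNIV. prob (?X k))"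
  proof (rule finite_measure_finite_Union)
    show "?X ` UNIV \<subseteq> events"
      by (rule image_subsetI, rule event_conj[OF past_determined_event J_event]) (rule no_ruin_determined_by_past(2))
  qed (auto simp: disjoint_family_on_def)
  also have "\<dots> = (\<Sum>k\<in>UNIV. prob {\<omega>\<in>space M. no_ruin C n \<omega> \<and> J n \<omega> = k \<and> J 0 \<omega> = i} * P $ k $ j)"
    by (intro sum.cong refl prob_step_J) (rule no_ruin_determined_by_past(2), assumption, simp)
  finally show ?thesis .
qed

lemma prob_ruin_time:
  "prob {\<omega>\<in>space M. (ruin_time C \<omega> = enat (Suc n) \<and> J (Suc n) \<omega> = j) \<and> J 0 \<omega> = i}
   = prob {\<omega>\<in>space M. no_ruin C n \<omega> \<and> J (Suc n) \<omega> = j \<and> J 0 \<omega> = i}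
     - prob {\<omega>\<in>space M. no_ruin C (Suc n) \<omega> \<and> J (Suc n) \<omega> = j \<and> J 0 \<omega> = i}"
proof -
  let ?A = "{\<omega>\<in>space M. no_ruin C n \<omega> \<and> J (Suc n) \<omega> = j \<and> J 0 \<omega> = i}"
  let ?B = "{\<omega>\<in>space M. no_ruin C (Suc n) \<omega> \<and> J (Suc n) \<omega> = j \<and> J 0 \<omega> = i}"
  have diff: "{\<omega>\<in>space M. (ruin_time C \<omega> = enat (Suc n) \<and> J (Suc n) \<omega> = j) \<and> J 0 \<omega> = i} = ?A - ?B"
    by (auto simp: ruin_time_eq_Suc_iff no_ruin_Suc)
  show ?thesis
    unfolding diff
  proof (rule finite_measure_Diff)
    show "?A \<in> events"
      by (rule event_conj[OF past_determined_event event_conj[OF J_event J_event]]) (rule no_ruin_past)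
    show "?B \<in> events"
      by (rule past_determined_event[of "Suc n"]) (rule no_ruin_determined_by_past(2))
  qed (auto simp: no_ruin_Suc)
qed

lemma mat_pow_P_nonneg: "0 \<le> mat_pow P n $ i $ j"
proof (induction n arbitrary: i)
  case (Suc n)
  then show ?case
    using P_stochastic by (auto simp: mat_pow_Suc mat_mult_entry stochastic_matrix_def intro!: sum_nonneg)
qed (simp add: mat_def)

text \<open>
  Guarantees that conditioning on any initial state is meaningful.
\<close>

lemma stationary_pos: "0 < \<pi> $ j"
proof -
  have \<pi>: "\<And>i. 0 \<le> \<pi> $ i" "(\<Sum>i\<in>UNIV. \<pi> $ i) = 1" "\<pi> v* P = \<pi>"
    using \<pi>_stationary by (auto simp: stationary_distribution_def)
  have step: "(\<Sum>i\<in>UNIV. \<pi> $ i * P $ i $ k) = \<pi> $ k" for k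
    using \<pi>(3) by (simp add: vec_eq_iff vector_matrix_mult_def mult.commute)
  have inv: "(\<Sum>i\<in>UNIV. \<pi> $ i * mat_pow P n $ i $ j) = \<pi> $ j" for n
  proof (induction n)
    case 0
    show ?case by (simp add: mat_def if_distrib cong: if_cong)
  next
    case (Suc n)
    have "(\<Sum>i\<in>UNIV. \<pi> $ i * mat_pow P (Suc n) $ i $ j)
        = (\<Sum>k\<in>UNIV. (\<Sum>i\<in>UNIV. \<pi> $ i * P $ i $ k) * mat_pow P n $ k $ j)"
      unfolding mat_pow_Suc mat_mult_entry sum_distrib_left sum_distrib_right
      by (subst sum.swap) (simp add: mult.assoc)
    then show ?case using Suc by (simp add: step)
  qed
  obtain i where i: "0 < \<pi> $ i"
    using \<pi>(1,2) by (metis less_eq_real_def sum.neutral zero_neq_one)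
  obtain n where n: "0 < mat_pow P n $ i $ j"
    using P_ergodic unfolding ergodic_matrix_def by blast
  have "0 < \<pi> $ i * mat_pow P n $ i $ j" using i n by simp
  also have "\<dots> \<le> (\<Sum>i\<in>UNIV. \<pi> $ i * mat_pow P n $ i $ j)"
    by (rule member_le_sum) (auto simp: \<pi>(1) mat_pow_P_nonneg)
  finally show ?thesis by (simp only: inv)
qed

end

section \<open>The law of the ruin time\<close>

text \<open>
  Both sides obey the same recurrence in \<open>n\<close> and agree at \<open>n = 0\<close> and at \<open>a = 0\<close>.
\<close>

lemma no_ruin_prob_eq_V_mat:
  fixes M :: "'a measure"
    and J :: "nat \<Rightarrow> 'a \<Rightarrow> 'n::{finite,linorder}"
    and C :: "nat \<Rightarrow> 'a \<Rightarrow> nat"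
    and P :: "'n sqmat"
    and \<Lambda> :: "nat \<Rightarrow> 'n sqmat"
    and \<pi> :: "(real, 'n) vec"
  assumes model: "map_risk_model M J C P \<Lambda> \<pi>"
  shows "map_risk_model.no_ruin_prob M J C n a i j = measure M {\<omega>\<in>space M. J 0 \<omega> = i} * V_mat \<Lambda> n a $ i $ j"
proof -
  interpret map_risk_model M J C P \<Lambda> \<pi> by (rule model)
  interpret positive_kernel \<Lambda>
    by unfold_locales (use \<Lambda>_nonneg \<Lambda>_sums \<Lambda>0_pos in \<open>auto simp: summable_def\<close>)
  show ?thesis
  proof (induction n arbitrary: a j)
    case 0
    show ?case
      by (cases "a = 0") (simp_all add: no_ruin_prob_0 V_mat_0 V_mat_high mat_def)
  next
    case (Suc n)
    show ?case
    proof (cases a)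
      case 0
      then show ?thesis by (simp add: no_ruin_prob_at_0 V_mat_0)
    next
      case (Suc b)
      show ?thesis
        unfolding Suc no_ruin_prob_rec V_mat_rec Suc.IH
        by (simp add: sum_component mat_mult_entry sum_distrib_left mult.assoc)
    qed
  qed
qed

theorem theorem3:
  fixes M :: "'a measure"
    and J :: "nat \<Rightarrow> 'a \<Rightarrow> 'n::{finite,linorder}"
    and C :: "nat \<Rightarrow> 'a \<Rightarrow> nat"
    and P :: "'n sqmat"
    and \<Lambda> :: "nat \<Rightarrow> 'n sqmat"
    and \<pi> :: "(real, 'n) vec"
  assumes model: "map_risk_model M J C P \<Lambda> \<pi>"
    and stationary_start: "\<And>i. \<P>(\<omega> in M. J 0 \<omega> = i) = \<pi> $ i"
  shows "ruin_matrix M J C 1 = P - \<Lambda> 0 \<and>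
         (\<forall>n>1. ruin_matrix M J C n =
            (\<Sum>y=1..n-1. V_mat \<Lambda> (n - 1) y ** P) - (\<Sum>y=1..n. V_mat \<Lambda> n y))"
proof -
  interpret map_risk_model M J C P \<Lambda> \<pi> by (rule model)
  interpret positive_kernel \<Lambda>
    by unfold_locales (use \<Lambda>_nonneg \<Lambda>_sums \<Lambda>0_pos in \<open>auto simp: summable_def\<close>)
  let ?p = "\<lambda>i. prob {\<omega>\<in>space M. J 0 \<omega> = i}"
  have p: "?p i \<noteq> 0" for i
    using stationary_start[of i] stationary_pos[of i] by simp
  have W: "no_ruin_prob n a i j = ?p i * V_mat \<Lambda> n a $ i $ j" for n a i j
    by (rule no_ruin_prob_eq_V_mat[OF model])
  have alive: "prob {\<omega>\<in>space M. no_ruin C n \<omega> \<and> J n \<omega> = j \<and> J 0 \<omega> = i} = ?p i * (\<Sum>y=1..n. V_mat \<Lambda> n y) $ i $ j"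
    if "0 < n" for n i j
    by (simp add: prob_no_ruin[OF that] W sum_component sum_distrib_left)
  have ruin: "ruin_matrix M J C (Suc n) $ i $ j =
      (prob {\<omega>\<in>space M. no_ruin C n \<omega> \<and> J (Suc n) \<omega> = j \<and> J 0 \<omega> = i}
       - ?p i * (\<Sum>y=1..Suc n. V_mat \<Lambda> (Suc n) y) $ i $ j) / ?p i" for n i j
    unfolding ruin_matrix_def vec_lambda_beta cond_prob_def prob_ruin_time alive[OF zero_less_Suc] ..
  have "ruin_matrix M J C 1 $ i $ j = (P - \<Lambda> 0) $ i $ j" for i j
  proof -
    have "prob {\<omega>\<in>space M. no_ruin C 0 \<omega> \<and> J 0 \<omega> = k \<and> J 0 \<omega> = i} = (if k = i then ?p i else 0)" for k
    proof -
      have "{\<omega>\<in>space M. no_ruin C 0 \<omega> \<and> J 0 \<omega> = k \<and> J 0 \<omega> = i} = (if k = i then {\<omega>\<in>space M. J 0 \<omega> = i} else {})"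
        by auto
      then show ?thesis by simp
    qed
    then have "prob {\<omega>\<in>space M. no_ruin C 0 \<omega> \<and> J (Suc 0) \<omega> = j \<and> J 0 \<omega> = i} = ?p i * P $ i $ j"
      unfolding prob_no_ruin_step by (simp add: if_distrib[of "\<lambda>x. x * _"] cong: if_cong)
    moreover have "V_mat \<Lambda> 1 1 = \<Lambda> 0"
      using V_mat_rec[of 0 0] by (simp add: V_mat_0)
    ultimately show ?thesis
      using p[of i] by (simp add: ruin[of 0, simplified] diff_divide_distrib)
  qed
  moreover have "ruin_matrix M J C n $ i $ j =
      ((\<Sum>y=1..n-1. V_mat \<Lambda> (n - 1) y ** P) - (\<Sum>y=1..n. V_mat \<Lambda> n y)) $ i $ j" if "1 < n" for n i j
  proof -
    have "n = Suc (n - 1)" "0 < n - 1" using that by simp_all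
    then obtain k where n: "n = Suc k" and k: "0 < k" by blast
    have "prob {\<omega>\<in>space M. no_ruin C k \<omega> \<and> J (Suc k) \<omega> = j \<and> J 0 \<omega> = i}
        = ?p i * (\<Sum>y=1..k. V_mat \<Lambda> k y ** P) $ i $ j"
    proof -
      have "(\<Sum>l\<in>UNIV. (\<Sum>y=1..k. V_mat \<Lambda> k y $ i $ l) * P $ l $ j) = (\<Sum>y=1..k. \<Sum>l\<in>UNIV. V_mat \<Lambda> k y $ i $ l * P $ l $ j)"
        unfolding sum_distrib_right by (rule sum.swap)
      then show ?thesis
        unfolding prob_no_ruin_step alive[OF k]
        by (simp add: sum_component mat_mult_entry mult.assoc flip: sum_distrib_left)
    qed
    then show ?thesis
      using p[of i] by (simp add: n ruin field_simps del: sum.cl_ivl_Suc)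
  qed
  ultimately show ?thesis
    by (simp add: vec_eq_iff)
qed

end
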